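(* Let $n\ge1$ be an integer. For the weight function $w_{-\frac12,-\frac12}$ on $\triangle^*$ the cubature rule $$c_{-\frac12,-\frac12}\iint_{\triangle^*}f(x,y)\,w_{-\frac12,-\frac12}(x,y)\,dx\,dy=\frac1{n^2}\sum_{\mathbf j\in\Upsilon_n}\omega^{(n)}_{\mathbf j}f\!\left(x\!\left(\tfrac{\mathbf j}n\right),y\!\left(\tfrac{\mathbf j}n\right)\right)$$ holds for all $f\in\Pi^*_{2n-1}$.
   Context: Let $\triangle=\{\mathbf t=(t_1,t_2,t_3)\in\mathbb R^3:t_1+t_2+t_3=0,\ 0\le t_2\le t_1\le-t_3\le1\}$. Define $x(\mathbf t)=\frac13\left(\cos\frac{2\pi(t_1-t_2)}3+\cos\frac{2\pi(2t_1+t_2)}3+\cos\frac{2\pi(t_1+2t_2)}3\right)$, $y(\mathbf t)=\frac13\left(\cos2\pi t_1+\cos2\pi t_2+\cos2\pi(t_1+t_2)\right)$, and let $\triangle^*\subset\mathbb R^2$ be the image of $\triangle$ under $\mathbf t\mapsto(x(\mathbf t),y(\mathbf t))$. The weight is $w_{\alpha,\beta}(x,y)=\frac{(4\pi^2)^{\alpha+\beta}}{3^{2\alpha+\beta}}(1+2y-3x^2)^\alpha(24x^3-y^2-12xy-6x-4y-1)^\beta$ (both factors are nonnegative on $\triangle^*$), and $c_{\alpha,\beta}=1/\int_{\triangle^*}w_{\alpha,\beta}(x,y)\,dx\,dy$. $\Upsilon_n=\{\mathbf j=(j_1,j_2,j_3)\in\mathbb Z^3:j_1+j_2+j_3=0,\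 j_1\equiv j_2\equiv j_3\ (\mathrm{mod}\ 3),\ 0\le j_2\le j_1\le-j_3\le n\}$, and for $\mathbf j\in\Upsilon_n$: $\omega^{(n)}_{\mathbf j}=12$ if $0<j_2<j_1<-j_3<n$; $\omega^{(n)}_{\mathbf j}=1$ if $\mathbf j=(0,0,0)$; $\omega^{(n)}_{\mathbf j}=2$ if $\mathbf j=(n,0,-n)$; $\omega^{(n)}_{\mathbf j}=3$ if $\mathbf j=(\frac n2,\frac n2,-n)$; $\omega^{(n)}_{\mathbf j}=6$ otherwise. $\Pi_m^*=\mathrm{span}\{x^{k_1}y^{k_2}:k_1,k_2\ge0,\ 2k_1+3k_2\le m\}$. *)

theory Defs
  imports "HOL-Analysis.Analysis" "HOL-Number_Theory.Cong" "HOL-Library.Function_Algebras"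
begin

definition triangle :: "(real \<times> real \<times> real) set" where
  "triangle = {(t1, t2, t3). t1 + t2 + t3 = 0 \<and> 0 \<le> t2 \<and> t2 \<le> t1 \<and> t1 \<le> - t3 \<and> - t3 \<le> 1}"

definition x_of :: "real \<times> real \<times> real \<Rightarrow> real" where
  "x_of = (\<lambda>(t1, t2, t3). 1/3 * (cos (2 * pi * (t1 - t2) / 3)
     + cos (2 * pi * (2 * t1 + t2) / 3) + cos (2 * pi * (t1 + 2 * t2) / 3)))"

definition y_of :: "real \<times> real \<times> real \<Rightarrow> real" where
  "y_of = (\<lambda>(t1, t2, t3). 1/3 * (cos (2 * pi * t1) + cos (2 * pi * t2) + cos (2 * pi * (t1 + t2))))"

definition triangle_star :: "(real \<times> real) set" where
  "triangle_star = (\<lambda>t. (x_of t, y_of t)) ` triangle"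

text \<open>
  On \<open>triangle_star\<close> both bases depending on \<open>(x, y)\<close> are nonnegative, so \<open>powr\<close> is the usual real
  power there, except that \<open>0 powr a = 0\<close>. For negative exponents this convention only affects
  the values on the zero sets of the two factors, which have Lebesgue measure zero.
\<close>

definition weight :: "real \<Rightarrow> real \<Rightarrow> real \<times> real \<Rightarrow> real" where
  "weight \<alpha> \<beta> = (\<lambda>(x, y). (4 * pi\<^sup>2) powr (\<alpha> + \<beta>) / 3 powr (2 * \<alpha> + \<beta>)
     * (1 + 2 * y - 3 * x\<^sup>2) powr \<alpha>
     * (24 * x ^ 3 - y\<^sup>2 - 12 * x * y - 6 * x - 4 * y - 1) powr \<beta>)"

definition norm_const :: "real \<Rightarrow> real \<Rightarrow> real" where
  "norm_const \<alpha> \<beta> = 1 / (LINT p:triangle_star|lborel. weight \<alpha> \<beta> p)"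

definition Upsilon :: "nat \<Rightarrow> (int \<times> int \<times> int) set" where
  "Upsilon n = {(j1, j2, j3). j1 + j2 + j3 = 0 \<and> [j1 = j2] (mod 3) \<and> [j2 = j3] (mod 3) \<and>
     0 \<le> j2 \<and> j2 \<le> j1 \<and> j1 \<le> - j3 \<and> - j3 \<le> int n}"

text \<open>
  The fourth case is \<open>(n/2, n/2, -n)\<close>, with the halves cleared; it is void for odd \<open>n\<close>.
  For \<open>n \<ge> 1\<close> the listed cases are mutually exclusive.
\<close>

definition omega :: "nat \<Rightarrow> int \<times> int \<times> int \<Rightarrow> real" where
  "omega n = (\<lambda>(j1, j2, j3).
     if 0 < j2 \<and> j2 < j1 \<and> j1 < - j3 \<and> - j3 < int n then 12
     else if (j1, j2, j3) = (0, 0, 0) then 1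
     else if (j1, j2, j3) = (int n, 0, - int n) then 2
     else if 2 * j1 = int n \<and> 2 * j2 = int n \<and> j3 = - int n then 3
     else 6)"

definition scaled :: "nat \<Rightarrow> int \<times> int \<times> int \<Rightarrow> real \<times> real \<times> real" where
  "scaled n = (\<lambda>(j1, j2, j3). (of_int j1 / of_nat n, of_int j2 / of_nat n, of_int j3 / of_nat n))"

text \<open>
  The function type is no instance of \<open>real_vector\<close>, so the span is taken with the locale version,
  for the pointwise operations.
\<close>

abbreviation (input) scale_fun :: "real \<Rightarrow> (real \<times> real \<Rightarrow> real) \<Rightarrow> real \<times> real \<Rightarrow> real" where
  "scale_fun c f \<equiv> (\<lambda>p. c * f p)"

lemma vector_space_scale_fun: "vector_space scale_fun"
  by unfold_locales (simp_all add: fun_eq_iff algebra_simps)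

definition Pi_star :: "nat \<Rightarrow> (real \<times> real \<Rightarrow> real) set" where
  "Pi_star m = module.span scale_fun
     {(\<lambda>(x, y). x ^ k1 * y ^ k2) | k1 k2 :: nat. 2 * k1 + 3 * k2 \<le> m}"

end

theory Submission
  imports Defs
begin

text \<open>
  In the coordinates \<open>t\<^sub>1 = 2u + v\<close>, \<open>t\<^sub>2 = v - u\<close> the functions \<open>x\<close> and \<open>y\<close> become \<open>xi\<close> and \<open>eta\<close>,
  which have period 1 in \<open>u\<close> and \<open>v\<close> and are invariant under negation and under permutations of
  \<open>(u, v, -u-v)\<close>. The triangle is a fundamental domain (the alcove) of the group generated by these
  symmetries, and the nodes are the points of the grid \<open>(1/n) \<int>\<^sup>2\<close> in it, weighted by the sizes of their
  orbits; so the sum is the sum over the whole grid modulo 1. The map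
  \<open>(xi, eta)\<close> is injective on the alcove and the weight is three times the inverse of its Jacobian, so the
  integral is, up to normalization, the mean of \<open>f (xi, eta)\<close> over the unit square.
  A frequency \<open>(k, l)\<close> of \<open>x^k1 y^k2\<close> satisfies \<open>\<bar>2k - l\<bar>, \<bar>2l - k\<bar>, \<bar>k + l\<bar> \<le> 2 k1 + 3 k2 < 2n\<close>,
  and among these only \<open>(0, 0)\<close> is a multiple of \<open>n\<close>. Hence the two means agree.
\<close>

section \<open>Folding sums over the grid\<close>

text \<open>Lattice points of a triangle in barycentric coordinates
  \<open>(a, b, N - a - b)\<close>, the third one left implicit.\<close>

definition bary :: "int \<Rightarrow> (int \<times> int) set" where
  "bary N = {(a, b). 0 \<le> a \<and> 0 \<le> b \<and> a + b \<le> N}"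

lemma finite_bary [simp]: "finite (bary N)"
  by (rule finite_subset[of _ "{0..N} \<times> {0..N}"]) (auto simp: bary_def)

lemma sum_bary_swap: "(\<Sum>(a, b)\<in>bary N. g a b) = (\<Sum>(a, b)\<in>bary N. g b a)"
  by (rule sum.reindex_bij_witness[of _ prod.swap prod.swap]) (auto simp: bary_def)

lemma sum_bary_reflect: "(\<Sum>(a, b)\<in>bary N. g a b) = (\<Sum>(a, b)\<in>bary N. g (N - a - b) b)"
  by (rule sum.reindex_bij_witness[of _ "\<lambda>(a, b). (N - a - b, b)" "\<lambda>(a, b). (N - a - b, b)"])
     (auto simp: bary_def)

text \<open>Only the average of a weight over the permutations of the barycentric coordinates
  \<open>(a, b, N - a - b)\<close> matters for the weighted sum of a symmetric function.\<close>
lemma sum_bary_symmetrize: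
  fixes h w :: "int \<Rightarrow> int \<Rightarrow> real"
  assumes "\<And>a b. h b a = h a b" "\<And>a b. h (N - a - b) b = h a b"
  shows "6 * (\<Sum>(a, b)\<in>bary N. w a b * h a b) = (\<Sum>(a, b)\<in>bary N.
    (w a b + w b a + w (N - a - b) b + w b (N - a - b) + w (N - a - b) a + w a (N - a - b)) * h a b)"
proof -
  define S where "S w = (\<Sum>(a, b)\<in>bary N. w a b * h a b)" for w
  have 1: "S w = S (\<lambda>a b. w b a)" for w
    unfolding S_def by (subst sum_bary_swap) (simp add: assms(1))
  have 2: "S w = S (\<lambda>a b. w (N - a - b) b)" for w
    unfolding S_def by (subst sum_bary_reflect) (simp add: assms(2))
  \<comment> \<open>The two transpositions generate all permutations of the three coordinates; the
    remaining rearrangements are words in them.\<close>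
  have 3: "S w = S (\<lambda>a b. w b (N - a - b))"
    by (subst 1, subst 2, rule refl)
  have 4: "S w = S (\<lambda>a b. w (N - a - b) a)"
    by (subst 2, subst 1) (simp add: algebra_simps)
  have 5: "S w = S (\<lambda>a b. w a (N - a - b))"
    by (subst 3, subst 1) (simp add: algebra_simps)
  have "6 * S w = S w + S (\<lambda>a b. w b a) + S (\<lambda>a b. w (N - a - b) b) + S (\<lambda>a b. w b (N - a - b))
      + S (\<lambda>a b. w (N - a - b) a) + S (\<lambda>a b. w a (N - a - b))"
    using 1[of w] 2[of w] 3 4 5 by simp
  then show ?thesis
    unfolding S_def by (simp add: sum.distrib[symmetric] case_prod_unfold algebra_simps)
qed

text \<open>The antidiagonal cuts the half-open square. The points with \<open>a + b \<ge> N\<close>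
  are carried by the point reflection to the triangle points with both coordinates positive; so
  interior points count twice, and on the boundary the half-open edges decide.\<close>

lemma sum_square_eq_sum_bary:
  fixes h :: "int \<Rightarrow> int \<Rightarrow> real"
  assumes neg: "\<And>a b. h (N - a) (N - b) = h a b"
  shows "(\<Sum>(a, b)\<in>{0..<N} \<times> {0..<N}. h a b)
    = (\<Sum>(a, b)\<in>bary N. (of_bool (a + b < N) + of_bool (0 < a \<and> 0 < b)) * h a b)"
proof -
  have "(\<Sum>(a, b)\<in>{0..<N} \<times> {0..<N}. h a b)
      = (\<Sum>(a, b)\<in>{0..<N} \<times> {0..<N}. of_bool (a + b < N) * h a b)
      + (\<Sum>(a, b)\<in>{0..<N} \<times> {0..<N}. of_bool (N \<le> a + b) * h a b)"
    unfolding sum.distrib[symmetric] by (rule sum.cong) auto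
  also have "(\<Sum>(a, b)\<in>{0..<N} \<times> {0..<N}. of_bool (a + b < N) * h a b)
      = (\<Sum>(a, b)\<in>bary N. of_bool (a + b < N) * h a b)"
    by (rule sum.mono_neutral_cong[OF finite_bary]) (auto simp: bary_def)
  also have "(\<Sum>(a, b)\<in>{0..<N} \<times> {0..<N}. of_bool (N \<le> a + b) * h a b)
      = (\<Sum>(a, b)\<in>{0<..N} \<times> {0<..N}. of_bool (a + b \<le> N) * h a b)"
    by (rule sum.reindex_bij_witness[of _ "\<lambda>(a, b). (N - a, N - b)" "\<lambda>(a, b). (N - a, N - b)"])
       (auto simp: neg)
  also have "\<dots> = (\<Sum>(a, b)\<in>bary N. of_bool (0 < a \<and> 0 < b) * h a b)"
    by (rule sum.mono_neutral_cong[OF finite_bary]) (auto simp: bary_def)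
  finally show ?thesis
    by (simp only: distrib_right case_prod_unfold sum.distrib)
qed

text \<open>The congruences modulo 3 say exactly that \<open>a = (j1 - j2) / 3\<close> and
  \<open>b = (j2 - j3) / 3\<close> are integers, and the chain of inequalities becomes
  \<open>0 \<le> a \<le> b \<le> n - a - b\<close>.\<close>

lemma Upsilon_eq_image:
  "Upsilon n = (\<lambda>(a, b). (2 * a + b, b - a, - (a + 2 * b))) `
    {(a, b). 0 \<le> a \<and> a \<le> b \<and> a + 2 * b \<le> int n}"
proof (intro equalityI subsetI)
  fix j assume j: "j \<in> Upsilon n"
  obtain j1 j2 j3 where j': "j = (j1, j2, j3)" by (cases j)
  have "3 dvd j1 - j2"
    using j unfolding j' Upsilon_def by (simp add: cong_iff_dvd_diff)
  then obtain a where a: "j1 - j2 = 3 * a" by (elim dvdE)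
  then have "(j1, j2, j3) = (2 * a + (j2 + a), (j2 + a) - a, - (a + 2 * (j2 + a)))"
    using j unfolding j' Upsilon_def by simp
  moreover have "0 \<le> a \<and> a \<le> j2 + a \<and> a + 2 * (j2 + a) \<le> int n"
    using j a unfolding j' Upsilon_def by simp
  ultimately show "j \<in> (\<lambda>(a, b). (2 * a + b, b - a, - (a + 2 * b))) `
    {(a, b). 0 \<le> a \<and> a \<le> b \<and> a + 2 * b \<le> int n}"
    unfolding j' by (intro image_eqI[of _ _ "(a, j2 + a)"]) simp_all
next
  fix j assume "j \<in> (\<lambda>(a, b). (2 * a + b, b - a, - (a + 2 * b))) `
    {(a, b). 0 \<le> a \<and> a \<le> b \<and> a + 2 * b \<le> int n}"
  then obtain a b where j: "j = (2 * a + b, b - a, - (a + 2 * b))" "0 \<le> a" "a \<le> b" "a + 2 * b \<le> int n"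
    by auto
  have "2 * a + b - (b - a) = 3 * a" "b - a - (- (a + 2 * b)) = 3 * b" by simp_all
  then have "3 dvd 2 * a + b - (b - a)" "3 dvd b - a - (- (a + 2 * b))" by (metis dvd_triv_left)+
  then show "j \<in> Upsilon n"
    using j(2-4) unfolding j(1) Upsilon_def by (simp add: cong_iff_dvd_diff)
qed

lemma sum_Upsilon_eq_sum_bary:
  fixes g :: "int \<times> int \<times> int \<Rightarrow> real"
  shows "(\<Sum>j\<in>Upsilon n. g j) = (\<Sum>(a, b)\<in>bary (int n).
    of_bool (a \<le> b \<and> a + 2 * b \<le> int n) * g (2 * a + b, b - a, - (a + 2 * b)))"
proof -
  let ?A = "{(a, b). 0 \<le> a \<and> a \<le> b \<and> a + 2 * b \<le> int n}"
  have "(\<Sum>j\<in>Upsilon n. g j) = (\<Sum>(a, b)\<in>?A. g (2 * a + b, b - a, - (a + 2 * b)))"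
    unfolding Upsilon_eq_image
    by (subst sum.reindex) (auto simp: inj_on_def case_prod_unfold intro!: sum.cong)
  also have "\<dots> = (\<Sum>(a, b)\<in>bary (int n).
      of_bool (a \<le> b \<and> a + 2 * b \<le> int n) * g (2 * a + b, b - a, - (a + 2 * b)))"
    by (rule sum.mono_neutral_cong_left[OF finite_bary]) (auto simp: bary_def)
  finally show ?thesis .
qed

text \<open>Both sides are weighted sums of \<open>h\<close> over \<open>bary\<close>. As
  \<open>h\<close> is symmetric, it is enough that the two weights have the same sum over the
  permutations of each triple \<open>(a, b, c)\<close>.\<close>

lemma sum_Upsilon_eq_sum_square:
  fixes h :: "int \<Rightarrow> int \<Rightarrow> real"
  assumes "n \<ge> 1"
    and sym: "\<And>a b. h b a = h a b" "\<And>a b. h (int n - a - b) b = h a b"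
    and neg: "\<And>a b. h (int n - a) (int n - b) = h a b"
    and g: "\<And>a b. g (2 * a + b, b - a, - (a + 2 * b)) = h a b"
  shows "(\<Sum>j\<in>Upsilon n. omega n j * g j)
    = (\<Sum>(a, b)\<in>{0..<int n} \<times> {0..<int n}. h a b)"
proof -
  define N where "N = int n"
  have N: "N \<ge> 1" using assms(1) by (simp add: N_def)
  let ?w1 = "\<lambda>a b. of_bool (a \<le> b \<and> a + 2 * b \<le> N) * omega n (2 * a + b, b - a, - (a + 2 * b))"
  let ?w2 = "\<lambda>a b. of_bool (a + b < N) + of_bool (0 < a \<and> 0 < b) :: real"
  \<comment> \<open>\<open>omega\<close> in barycentric coordinates, extended by zero off the sorted
    triples. The node \<open>(n, 0, -n)\<close> becomes the centroid \<open>a = b = c\<close>, and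
    \<open>(n/2, n/2, -n)\<close> the edge midpoint \<open>a = 0\<close>,
    \<open>b = c\<close>.\<close>
  define E :: "int \<Rightarrow> int \<Rightarrow> int \<Rightarrow> real" where "E a b c =
    (if a \<le> b \<and> b \<le> c then if 0 < a \<and> a < b \<and> b < c then 12 else if a = 0 \<and> b = 0 then 1
     else if a = b \<and> b = c then 2 else if a = 0 \<and> b = c then 3 else 6 else 0)" for a b c
  have E: "?w1 a b = E a b (N - a - b)" for a b
  proof (cases "a \<le> b \<and> a + 2 * b \<le> N")
    case True
    then have "(0 < b - a \<and> b - a < 2 * a + b \<and> 2 * a + b < a + 2 * b \<and> a + 2 * b < N)
        = (0 < a \<and> a < b \<and> b < N - a - b)"
      "(2 * a + b = 0 \<and> b - a = 0 \<and> a + 2 * b = 0) = (a = 0 \<and> b = 0)"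
      "(2 * a + b = N \<and> b - a = 0 \<and> a + 2 * b = N) = (a = b \<and> b = N - a - b)"
      "(2 * (2 * a + b) = N \<and> 2 * (b - a) = N \<and> a + 2 * b = N) = (a = 0 \<and> b = N - a - b)"
      "a \<le> b" "b \<le> N - a - b"
      by presburger+
    with True show ?thesis
      unfolding omega_def E_def N_def[symmetric] split_conv prod.inject neg_equal_iff_equal
        neg_equal_0_iff_equal minus_minus by (simp only: if_True of_bool_eq simp_thms mult_1)
  next
    case False
    then have "\<not> (a \<le> b \<and> b \<le> N - a - b)" by presburger
    with False show ?thesis by (simp only: E_def if_False of_bool_eq mult_zero_left)
  qed
  define W :: "int \<Rightarrow> int \<Rightarrow> int \<Rightarrow> real" where
    "W a b c = of_bool (0 < c) + of_bool (0 < a \<and> 0 < b)" for a b c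
  have W: "?w2 a b = W a b (N - a - b)" for a b
    by (simp add: W_def algebra_simps)
  define T where "T a b c = E a b c + E b a c + E c b a + E b c a + E c a b + E a c b" for a b c
  define R where "R a b c = W a b c + W b a c + W c b a + W b c a + W c a b + W a c b" for a b c
  \<comment> \<open>On sorted triples only the pattern of zeros and ties matters. At the zero triple
    \<open>T\<close> is 6 and \<open>R\<close> is 0, whence the condition \<open>0 < c\<close> here
    and \<open>n \<ge> 1\<close> above.\<close>
  have sorted: "T a b c = R a b c" if ord: "0 \<le> a" "a \<le> b" "b \<le> c" "0 < c" for a b c
  proof -
    consider "0 = a" "0 = b" | "0 = a" "0 < b" "b < c" | "0 = a" "0 < b" "b = c"
      | "0 < a" "a = b" "b = c" | "0 < a" "a < b" "b = c" | "0 < a" "a = b" "b < c" | "0 < a" "a < b" "b < c"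
      using ord unfolding order_le_less by blast
    then show ?thesis
      by cases (use ord in \<open>simp_all add: T_def E_def R_def W_def\<close>)
  qed
  have symT: "T b a c = T a b c" "T a c b = T a b c" for a b c
    by (simp_all only: T_def add_ac)
  have symR: "R b a c = R a b c" "R a c b = R a b c" for a b c
    by (simp_all only: R_def add_ac)
  have TR: "T a b c = R a b c" if "a \<ge> 0" "b \<ge> 0" "c \<ge> 0" "a + b + c \<ge> 1" for a b c
  proof -
    have pos: "a > 0 \<or> b > 0 \<or> c > 0" using that by linarith
    have "a \<le> b \<and> b \<le> c \<or> a \<le> c \<and> c \<le> b \<or> b \<le> a \<and> a \<le> c \<or> b \<le> c \<and> c \<le> a \<or> c \<le> a \<and> a \<le> b \<or> c \<le> b \<and> b \<le> a"
      using linear[of a b] linear[of b c] linear[of a c] by blast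
    then show ?thesis
      using that(1-3) pos sorted by (metis symT symR order_less_le_trans)
  qed
  have "6 * (\<Sum>(a, b)\<in>bary N. ?w1 a b * h a b) = 6 * (\<Sum>(a, b)\<in>bary N. ?w2 a b * h a b)"
    unfolding sum_bary_symmetrize[of h N, OF sym[folded N_def]]
  proof (intro sum.cong refl, clarify, goal_cases)
    case (1 a b)
    define c where "c = N - a - b"
    have abc: "a \<ge> 0" "b \<ge> 0" "c \<ge> 0" "a + b + c \<ge> 1"
      using 1 N by (auto simp: bary_def c_def)
    have perm: "N - a - b = c" "N - b - a = c" "N - c - b = a" "N - b - c = a" "N - c - a = b" "N - a - c = b"
      by (simp_all add: c_def)
    show ?case
      using TR[OF abc] unfolding T_def R_def by (simp only: E W perm)
  qed
  then show ?thesis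
    unfolding sum_Upsilon_eq_sum_bary N_def sum_square_eq_sum_bary[of h, OF neg] g
    by (simp add: mult.assoc)
qed

section \<open>Trigonometric polynomials\<close>

definition ctrig :: "int \<Rightarrow> int \<Rightarrow> real \<times> real \<Rightarrow> real" where
  "ctrig k l = (\<lambda>(u, v). cos (2 * pi * (of_int k * u + of_int l * v)))"

text \<open>The three forms define a norm on frequencies with a hexagonal unit ball. The frequencies
  of \<open>xi\<close> have norm 2 and those of \<open>eta\<close> norm 3, which mirrors the weights
  of \<open>x\<close> and \<open>y\<close> in \<open>Pi_star\<close>.\<close>

inductive_set trig_span :: "int \<Rightarrow> (real \<times> real \<Rightarrow> real) set" for m where
  ctrig: "\<bar>2 * k - l\<bar> \<le> m \<Longrightarrow> \<bar>2 * l - k\<bar> \<le> m \<Longrightarrow> \<bar>k + l\<bar> \<le> m \<Longrightarrow> ctrig k l \<in> trig_span m"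
| add: "F \<in> trig_span m \<Longrightarrow> G \<in> trig_span m \<Longrightarrow> (\<lambda>z. F z + G z) \<in> trig_span m"
| scale: "F \<in> trig_span m \<Longrightarrow> (\<lambda>z. c * F z) \<in> trig_span m"

lemma ctrig_mult: "ctrig k l z * ctrig k' l' z
    = 1/2 * (ctrig (k + k') (l + l') z + ctrig (k - k') (l - l') z)"
  by (cases z) (simp add: ctrig_def cos_times_cos algebra_simps)

text \<open>A product of cosines has the sum and the difference of the frequencies, and the
  hexagonal norm is subadditive.\<close>

lemma trig_span_mult:
  assumes "F \<in> trig_span m" "G \<in> trig_span m'"
  shows "(\<lambda>z. F z * G z) \<in> trig_span (m + m')"
  using assms(1)
proof induction
  case (ctrig k l)
  show ?case
    using assms(2)
  proof induction
    case (ctrig k' l')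
    show ?case
      unfolding ctrig_mult
      by (intro trig_span.intros) (use ctrig \<open>\<bar>2 * k - l\<bar> \<le> m\<close> \<open>\<bar>2 * l - k\<bar> \<le> m\<close> \<open>\<bar>k + l\<bar> \<le> m\<close> in auto)
  next
    case (add F G)
    then show ?case by (simp add: distrib_left trig_span.add)
  next
    case (scale F c)
    then show ?case using trig_span.scale[of _ "m + m'" c] by (simp add: mult.left_commute)
  qed
next
  case (add F G)
  then show ?case by (simp add: distrib_right trig_span.add)
next
  case (scale F c)
  then show ?case using trig_span.scale[of _ "m + m'" c] by (simp add: mult.assoc)
qed

lemma trig_span_mono:
  assumes "F \<in> trig_span m" "m \<le> m'"
  shows "F \<in> trig_span m'"
  using assms(1) by induction (use assms(2) in \<open>auto intro: trig_span.intros\<close>)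

lemma trig_span_power:
  assumes "F \<in> trig_span m"
  shows "(\<lambda>z. F z ^ k) \<in> trig_span (int k * m)"
proof (induction k)
  case 0
  have "ctrig 0 0 \<in> trig_span 0" by (rule trig_span.ctrig) auto
  then show ?case by (simp add: ctrig_def case_prod_unfold)
next
  case (Suc k)
  show ?case using trig_span_mult[OF assms Suc] by (simp add: algebra_simps)
qed

definition xi :: "real \<times> real \<Rightarrow> real" where
  "xi = (\<lambda>(u, v). 1/3 * (cos (2 * pi * u) + cos (2 * pi * v) + cos (2 * pi * (u + v))))"

definition eta :: "real \<times> real \<Rightarrow> real" where
  "eta = (\<lambda>(u, v). 1/3 * (cos (2 * pi * (2 * u + v)) + cos (2 * pi * (v - u)) + cos (2 * pi * (u + 2 * v))))"

lemma xi_in_trig_span: "xi \<in> trig_span 2"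
proof -
  have "xi = (\<lambda>z. 1/3 * (ctrig 1 0 z + ctrig 0 1 z + ctrig 1 1 z))"
    by (auto simp: xi_def ctrig_def)
  also have "\<dots> \<in> trig_span 2" by (intro trig_span.intros) auto
  finally show ?thesis .
qed

lemma eta_in_trig_span: "eta \<in> trig_span 3"
proof -
  have "eta = (\<lambda>z. 1/3 * (ctrig 2 1 z + ctrig (-1) 1 z + ctrig 1 2 z))"
    by (auto simp: eta_def ctrig_def)
  also have "\<dots> \<in> trig_span 3" by (intro trig_span.intros) auto
  finally show ?thesis .
qed

lemma monomial_in_trig_span:
  assumes "2 * int k1 + 3 * int k2 \<le> m"
  shows "(\<lambda>z. xi z ^ k1 * eta z ^ k2) \<in> trig_span m"
  using trig_span_mult[OF trig_span_power[OF xi_in_trig_span, of k1]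
      trig_span_power[OF eta_in_trig_span, of k2]]
  by (rule trig_span_mono) (use assms in simp)

section \<open>Grid means of cosines\<close>

lemma sum_cis_roots:
  assumes "n \<ge> 1"
  shows "(\<Sum>a\<in>{0..<int n}. cis (2 * pi * of_int k * of_int a / real n))
    = (if int n dvd k then of_nat n else 0)"
proof -
  define w where "w = cis (2 * pi * of_int k / real n)"
  have "(\<Sum>a\<in>{0..<int n}. cis (2 * pi * of_int k * of_int a / real n)) = (\<Sum>a<n. w ^ a)"
    by (rule sum.reindex_bij_witness[of _ int nat])
       (auto simp: w_def Complex.DeMoivre field_simps)
  moreover have "w ^ n = 1"
    using assms by (simp add: w_def Complex.DeMoivre cis_multiple_2pi)
  moreover have "w = 1 \<longleftrightarrow> int n dvd k"
  proof
    assume "w = 1"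
    then have "cos (2 * pi * of_int k / real n) = 1"
      unfolding w_def by (metis cis.simps(1) one_complex.simps(1))
    then obtain j :: int where "2 * pi * of_int k / real n = of_int j * 2 * pi"
      by (auto simp: cos_one_2pi_int)
    then have "real_of_int k = of_int (j * int n)"
      using assms by (simp add: field_simps)
    then have "k = j * int n"
      by (simp only: of_int_eq_iff)
    then show "int n dvd k" by simp
  next
    assume "int n dvd k"
    then obtain j where "k = int n * j" by (elim dvdE)
    then have "2 * pi * of_int k / real n = 2 * pi * of_int j"
      using assms by simp
    then show "w = 1" by (simp add: w_def cis_multiple_2pi)
  qed
  ultimately show ?thesis
    by (auto simp: sum_gp_strict)
qed

lemma sum_ctrig_grid:
  assumes "n \<ge> 1"
  shows "(\<Sum>(a, b)\<in>{0..<int n} \<times> {0..<int n}. ctrig k l (of_int a / real n, of_int b / real n))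
    = (if int n dvd k \<and> int n dvd l then (real n)\<^sup>2 else 0)"
proof -
  have "(\<Sum>(a, b)\<in>{0..<int n} \<times> {0..<int n}. ctrig k l (of_int a / real n, of_int b / real n))
    = Re (\<Sum>(a, b)\<in>{0..<int n} \<times> {0..<int n}. cis (2 * pi * of_int k * of_int a / real n) * cis (2 * pi * of_int l * of_int b / real n))"
    unfolding Re_sum
    by (intro sum.cong refl) (auto simp: cis_mult ctrig_def algebra_simps)
  also have "\<dots> = Re ((\<Sum>a\<in>{0..<int n}. cis (2 * pi * of_int k * of_int a / real n)) * (\<Sum>a\<in>{0..<int n}. cis (2 * pi * of_int l * of_int a / real n)))"
    by (simp add: sum_product sum.cartesian_product)
  also have "\<dots> = (if int n dvd k \<and> int n dvd l then (real n)\<^sup>2 else 0)"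
    unfolding sum_cis_roots[OF assms] by (simp add: power2_eq_square)
  finally show ?thesis .
qed

text \<open>After division by \<open>n\<close> the three forms in \<open>r\<close> and
  \<open>s\<close> have modulus at most 1. Now \<open>3 * r\<close> is the sum of the first and the
  third, so \<open>r = 0\<close>, and likewise \<open>s = 0\<close>. Strictness matters: the
  frequency \<open>(n, 0)\<close> attains \<open>2 * n\<close>.\<close>

lemma no_aliasing:
  fixes n k l :: int
  assumes "n \<ge> 1" "n dvd k" "n dvd l"
    and "\<bar>2 * k - l\<bar> < 2 * n" "\<bar>2 * l - k\<bar> < 2 * n" "\<bar>k + l\<bar> < 2 * n"
  shows "k = 0 \<and> l = 0"
proof -
  obtain r s where k: "k = n * r" and l: "l = n * s" using assms(2,3) by (elim dvdE)
  have *: "\<bar>t\<bar> < 2" if "\<bar>n * t\<bar> < 2 * n" for t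
  proof -
    have "n * \<bar>t\<bar> < n * 2" using that assms(1) by (simp add: abs_mult)
    then show ?thesis using assms(1) by simp
  qed
  have "\<bar>2 * r - s\<bar> < 2" "\<bar>2 * s - r\<bar> < 2" "\<bar>r + s\<bar> < 2"
    using assms(4-6) by (intro *; simp add: k l algebra_simps)+
  then have "r = 0 \<and> s = 0" by presburger
  then show ?thesis by (simp add: k l)
qed

section \<open>Folding integrals over the unit square\<close>

lemma distr_lborel_comp:
  assumes "\<phi> \<in> borel_measurable borel" "\<psi> \<in> borel_measurable borel"
    and "distr lborel lborel \<phi> = lborel" "distr lborel lborel \<psi> = lborel"
  shows "distr lborel lborel (\<lambda>z. \<phi> (\<psi> z)) = lborel"
proof -
  have "distr lborel lborel (\<phi> \<circ> \<psi>) = distr (distr lborel lborel \<psi>) lborel \<phi>"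
    using assms(1,2) by (intro distr_distr[symmetric]) auto
  then show ?thesis using assms(3,4) by (simp add: comp_def)
qed

lemma distr_lborel_swap: "distr lborel lborel (\<lambda>(a, b). (b, a)) = (lborel :: (real \<times> real) measure)"
  using lborel_pair.distr_pair_swap[where 'a=real and 'b=real] by (simp add: lborel_prod)

text \<open>By Fubini: for fixed \<open>b\<close> the map is a reflection of the line, which
  preserves Lebesgue measure. The centre may vary with \<open>b\<close>, so that the exchange of
  \<open>a\<close> with \<open>1 - a - b\<close> is covered.\<close>

lemma distr_lborel_reflect:
  fixes f :: "real \<Rightarrow> real"
  assumes [measurable]: "f \<in> borel_measurable borel"
  shows "distr lborel lborel (\<lambda>(a, b). (f b - a, b)) = lborel"
proof (rule measure_eqI)
  fix X :: "(real \<times> real) set"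
  assume "X \<in> sets (distr lborel lborel (\<lambda>(a, b). (f b - a, b)))"
  then have X [measurable]: "X \<in> sets borel" by simp
  have [measurable]: "(\<lambda>z. (f (snd z) - fst z, snd z)) \<in> borel_measurable borel"
    unfolding borel_prod[symmetric] by measurable
  have [measurable]: "X \<in> sets (borel \<Otimes>\<^sub>M borel)" using X unfolding borel_prod .
  have "emeasure (distr lborel lborel (\<lambda>(a, b). (f b - a, b))) X
      = (\<integral>\<^sup>+z. indicator X z \<partial>distr lborel lborel (\<lambda>(a, b). (f b - a, b)))"
    by simp
  also have "\<dots> = (\<integral>\<^sup>+z. indicator X (f (snd z) - fst z, snd z) \<partial>(lborel \<Otimes>\<^sub>M lborel))"
    by (subst nn_integral_distr) (auto simp: case_prod_unfold lborel_prod)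
  also have "\<dots> = (\<integral>\<^sup>+b. \<integral>\<^sup>+a. indicator X (f b - a, b) \<partial>lborel \<partial>lborel)"
    by (subst lborel_pair.nn_integral_snd[symmetric]) auto
  also have "\<dots> = (\<integral>\<^sup>+b. \<integral>\<^sup>+a. indicator X (a, b) \<partial>lborel \<partial>lborel)"
  proof (rule nn_integral_cong)
    fix b :: real
    show "(\<integral>\<^sup>+a. indicator X (f b - a, b) \<partial>lborel) = (\<integral>\<^sup>+a. indicator X (a, b) \<partial>lborel)"
      by (subst (2) nn_integral_real_affine[where c="-1" and t="f b"]) auto
  qed
  also have "\<dots> = (\<integral>\<^sup>+z. indicator X z \<partial>(lborel \<Otimes>\<^sub>M lborel))"
    by (subst lborel_pair.nn_integral_snd[symmetric]) auto
  finally show "emeasure (distr lborel lborel (\<lambda>(a, b). (f b - a, b))) X = emeasure lborel X"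
    by (simp add: lborel_prod)
qed simp

lemma distr_lborel_neg: "distr lborel lborel (\<lambda>(a, b). (1 - a, 1 - b)) = (lborel :: (real \<times> real) measure)"
proof -
  let ?s = "\<lambda>(a, b). (b, a) :: real \<times> real"
  let ?f = "\<lambda>(a, b). (1 - a, b) :: real \<times> real"
  have "distr lborel lborel ?f = lborel"
    using distr_lborel_reflect[of "\<lambda>b. 1"] by simp
  moreover have "?f \<in> borel_measurable borel" "?s \<in> borel_measurable borel"
    by (auto simp: case_prod_unfold intro!: borel_measurable_continuous_onI continuous_intros)
  ultimately have fs: "distr lborel lborel (\<lambda>z. ?f (?s z)) = lborel"
    using distr_lborel_comp[of ?f ?s] distr_lborel_swap by blast
  have "(\<lambda>z. ?f (?s z)) \<in> borel_measurable borel"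
    by (auto simp: case_prod_unfold intro!: borel_measurable_continuous_onI continuous_intros)
  \<comment> \<open>\<open>?f\<close> after \<open>?s\<close> is the quarter turn
    \<open>(a, b) \<mapsto> (1 - b, a)\<close> of the square; applied twice it is the reflection in
    the centre.\<close>
  from distr_lborel_comp[OF this this fs fs] show ?thesis
    by (simp add: case_prod_unfold)
qed

text \<open>Discards the walls, along which the pieces of the square overlap and the Jacobian
  vanishes.\<close>

lemma AE_lborel_line:
  fixes p q r :: real
  assumes "p \<noteq> 0 \<or> q \<noteq> 0"
  shows "AE z in lborel. p * fst z + q * snd z \<noteq> r"
proof -
  let ?S = "{z. (p, q) \<bullet> z = r}"
  have "negligible ?S"
    using assms by (intro negligible_hyperplane) (auto simp: zero_prod_def)
  moreover have "?S \<in> sets borel"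
    by (intro borel_closed closed_hyperplane)
  ultimately have "?S \<in> null_sets lborel"
    by (simp add: negligible_iff_null_sets null_sets_completion_iff)
  then show ?thesis
    by (rule AE_I') (auto simp: inner_prod_def)
qed

text \<open>With \<open>c = 1 - a - b\<close> this is \<open>0 \<le> a \<le> b \<le> c\<close>, one
  of the six chambers of \<open>std_triangle\<close>.\<close>

definition alcove :: "(real \<times> real) set" where
  "alcove = {(a, b). 0 \<le> a \<and> a \<le> b \<and> a + 2 * b \<le> 1}"

definition std_triangle :: "(real \<times> real) set" where
  "std_triangle = {(a, b). 0 \<le> a \<and> 0 \<le> b \<and> a + b \<le> 1}"

lemma compact_alcove: "compact alcove" and compact_std_triangle: "compact std_triangle"
proof -
  have "alcove \<subseteq> cbox (0, 0) (1, 1)" "std_triangle \<subseteq> cbox (0, 0) (1, 1)"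
    by (auto simp: alcove_def std_triangle_def cbox_Pair_eq)
  then have "bounded alcove" "bounded std_triangle"
    using bounded_cbox bounded_subset by blast+
  moreover have "closed alcove" "closed std_triangle"
    unfolding alcove_def std_triangle_def case_prod_unfold
    by (intro closed_Collect_conj closed_Collect_le continuous_intros)+
  ultimately show "compact alcove" "compact std_triangle"
    by (simp_all add: compact_eq_bounded_closed)
qed

text \<open>Distinct numbers are in exactly one of the six orders, and all are nonnegative if the
  least one is.\<close>

lemma of_bool_sorted_perms:
  fixes a b c :: real
  assumes "a \<noteq> b" "b \<noteq> c" "a \<noteq> c"
  shows "(of_bool (0 \<le> a \<and> 0 \<le> b \<and> 0 \<le> c) :: real)
    = of_bool (0 \<le> a \<and> a \<le> b \<and> b \<le> c) + of_bool (0 \<le> b \<and> b \<le> a \<and> a \<le> c)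
    + of_bool (0 \<le> c \<and> c \<le> b \<and> b \<le> a) + of_bool (0 \<le> b \<and> b \<le> c \<and> c \<le> a)
    + of_bool (0 \<le> c \<and> c \<le> a \<and> a \<le> b) + of_bool (0 \<le> a \<and> a \<le> c \<and> c \<le> b)"
proof -
  consider "a < b" "b < c" "a < c" | "b < a" "a < c" "b < c" | "c < b" "b < a" "c < a"
    | "b < c" "c < a" "b < a" | "c < a" "a < b" "c < b" | "a < c" "c < b" "a < b"
    using assms by (metis linorder_neqE less_trans)
  then show ?thesis
    by cases (simp_all only: of_bool_def, auto)
qed

text \<open>For an invariant integrand the symmetry moves onto the indicator, so that integrals over
  different chambers can be added pointwise.\<close>

lemma LINT_symmetry:
  fixes F :: "'a::euclidean_space \<Rightarrow> real"
  assumes "distr lborel lborel \<phi> = lborel" and [measurable]: "\<phi> \<in> borel_measurable borel" "F \<in> borel_measurable borel" "S \<in> sets borel"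
    and "\<And>z. F (\<phi> z) = F z"
  shows "(LINT z:S|lborel. F z) = (LINT z|lborel. indicator S (\<phi> z) * F z)"
proof -
  have "(LINT z:S|lborel. F z) = (LINT z|distr lborel lborel \<phi>. indicator S z * F z)"
    unfolding assms(1) set_lebesgue_integral_def by simp
  also have "\<dots> = (LINT z|lborel. indicator S (\<phi> z) * F z)"
    by (subst integral_distr) (simp_all add: assms(5))
  finally show ?thesis .
qed

lemma integrable_indicator_comp:
  fixes F :: "'a::euclidean_space \<Rightarrow> real"
  assumes "distr lborel lborel \<phi> = lborel" and [measurable]: "\<phi> \<in> borel_measurable borel"
    and "continuous_on UNIV F" "compact S" and "\<And>z. F (\<phi> z) = F z"
  shows "integrable lborel (\<lambda>z. indicator S (\<phi> z) * F z)"
proof -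
  have [measurable]: "S \<in> sets borel" "F \<in> borel_measurable borel"
    using assms by (auto intro: borel_compact borel_measurable_continuous_onI)
  have "integrable (distr lborel lborel \<phi>) (\<lambda>z. indicator S z * F z)"
    unfolding assms(1)
    using borel_integrable_compact[OF \<open>compact S\<close> continuous_on_subset[OF assms(3)]] by simp
  then show ?thesis
    by (subst (asm) integrable_distr_eq) (simp_all add: assms(5))
qed

text \<open>Continuous counterpart of \<open>sum_Upsilon_eq_sum_square\<close>: two triangles in the
  square, six chambers in each. Walls are null sets, so no boundary weights arise.\<close>

lemma LINT_box_eq_LINT_alcove:
  fixes F :: "real \<times> real \<Rightarrow> real"
  assumes cont: "continuous_on UNIV F"
    and sym: "\<And>a b. F (b, a) = F (a, b)" "\<And>a b. F (1 - a - b, b) = F (a, b)"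
    and neg: "\<And>a b. F (1 - a, 1 - b) = F (a, b)"
  shows "(LINT z:cbox (0, 0) (1, 1)|lborel. F z) = 12 * (LINT z:alcove|lborel. F z)"
proof -
  note [measurable] = borel_compact[OF compact_alcove] borel_compact[OF compact_std_triangle]
    borel_measurable_continuous_onI[OF cont]
  let ?s = "\<lambda>(a, b). (b, a) :: real \<times> real"
  let ?r = "\<lambda>(a, b). (1 - a - b, b) :: real \<times> real"
  let ?n = "\<lambda>(a, b). (1 - a, 1 - b) :: real \<times> real"
  \<comment> \<open>The measure preserving symmetries of \<open>F\<close>; they are closed under
    composition.\<close>
  define mp :: "(real \<times> real \<Rightarrow> real \<times> real) \<Rightarrow> bool" where
    "mp \<phi> \<longleftrightarrow> \<phi> \<in> borel_measurable borel \<and> distr lborel lborel \<phi> = lborel \<and> (\<forall>z. F (\<phi> z) = F z)" for \<phi>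
  have comp: "mp (\<lambda>z. \<phi> (\<psi> z))" if "mp \<phi>" "mp \<psi>" for \<phi> \<psi>
    using that measurable_compose[of \<psi> borel borel \<phi> borel] distr_lborel_comp[of \<phi> \<psi>]
    unfolding mp_def by (simp del: split_paired_All)
  have meas: "\<phi> \<in> borel_measurable borel" if "continuous_on UNIV \<phi>" for \<phi> :: "real \<times> real \<Rightarrow> real \<times> real"
    using that by (rule borel_measurable_continuous_onI)
  have s: "mp ?s"
    unfolding mp_def
    by (auto simp: sym(1) case_prod_unfold distr_lborel_swap[unfolded case_prod_unfold] intro!: meas continuous_intros)
  have "(\<lambda>(a, b). (1 - b - a, b)) = ?r" by auto
  then have "distr lborel lborel ?r = lborel"
    using distr_lborel_reflect[of "\<lambda>b. 1 - b"] by simp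
  then have r: "mp ?r"
    unfolding mp_def by (auto simp: sym(2) case_prod_unfold intro!: meas continuous_intros)
  have n: "mp ?n"
    unfolding mp_def using distr_lborel_neg
    by (auto simp: neg case_prod_unfold intro!: meas continuous_intros)
  have id: "mp (\<lambda>z. z)"
    by (simp add: mp_def distr_id)
  define J where "J S \<phi> = (\<lambda>z. indicator S (\<phi> z) * F z)" for S :: "(real \<times> real) set" and \<phi> :: "real \<times> real \<Rightarrow> real \<times> real"
  have J: "integrable lborel (J S \<phi>)" "integral\<^sup>L lborel (J S \<phi>) = (LINT z:S|lborel. F z)"
    if "mp \<phi>" "compact S" for S \<phi>
    using that integrable_indicator_comp[of \<phi> F S] LINT_symmetry[of \<phi> F S] cont borel_compact[of S]
    unfolding mp_def J_def by (auto simp: borel_measurable_continuous_onI)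
  have T: "(LINT z:std_triangle|lborel. F z) = 6 * (LINT z:alcove|lborel. F z)"
  proof -
    let ?J = "J alcove"
    note mp = id s r comp[OF s r] comp[OF r s] comp[OF s comp[OF r s]]
    note J' = mp[THEN J(1), OF compact_alcove] mp[THEN J(2), OF compact_alcove] J[OF id compact_std_triangle]
    \<comment> \<open>The six words in \<open>?s\<close> and \<open>?r\<close> are the permutations
      of \<open>(a, b, c)\<close>, in the order of \<open>of_bool_sorted_perms\<close>. The excluded
      lines are \<open>a = b\<close>, \<open>b = c\<close> and \<open>a = c\<close>.\<close>
    have "AE z in lborel. J std_triangle (\<lambda>z. z) z = ?J (\<lambda>z. z) z + ?J ?s z + ?J ?r z
        + ?J (\<lambda>z. ?s (?r z)) z + ?J (\<lambda>z. ?r (?s z)) z + ?J (\<lambda>z. ?s (?r (?s z))) z"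
      using AE_lborel_line[of 1 "-1" 0, simplified] AE_lborel_line[of 1 2 1, simplified]
        AE_lborel_line[of 2 1 1, simplified]
    proof eventually_elim
      case (elim z)
      obtain a b where z: "z = (a, b)" by (cases z)
      define c where "c = 1 - a - b"
      have "a \<noteq> b" "b \<noteq> c" "a \<noteq> c" using elim by (auto simp: z c_def)
      from of_bool_sorted_perms[OF this]
      have "(indicator std_triangle z :: real) = indicator alcove z + indicator alcove (?s z) + indicator alcove (?r z)
        + indicator alcove (?s (?r z)) + indicator alcove (?r (?s z)) + indicator alcove (?s (?r (?s z)))"
        unfolding indicator_def of_bool_def z std_triangle_def alcove_def c_def by (simp add: algebra_simps)
      then show ?case
        unfolding J_def by (simp only: distrib_right)
    qed
    then have "integral\<^sup>L lborel (J std_triangle (\<lambda>z. z)) = (LINT z|lborel. ?J (\<lambda>z. z) z + ?J ?s z + ?J ?r z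
        + ?J (\<lambda>z. ?s (?r z)) z + ?J (\<lambda>z. ?r (?s z)) z + ?J (\<lambda>z. ?s (?r (?s z))) z)"
      by (intro integral_cong_AE borel_measurable_add borel_measurable_integrable J')
    then show ?thesis
      by (simp add: J')
  qed
  have "AE z in lborel. J (cbox (0, 0) (1, 1)) (\<lambda>z. z) z = J std_triangle (\<lambda>z. z) z + J std_triangle ?n z"
    using AE_lborel_line[of 1 1 1, simplified]
  proof eventually_elim
    case (elim z)
    obtain a b where z: "z = (a, b)" by (cases z)
    have "(indicator (cbox (0, 0) (1, 1)) z :: real) = indicator std_triangle z + indicator std_triangle (?n z)"
      using elim unfolding indicator_def of_bool_def z std_triangle_def cbox_Pair_eq by auto
    then show ?case
      unfolding J_def by (simp only: distrib_right)
  qed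
  then have "integral\<^sup>L lborel (J (cbox (0, 0) (1, 1)) (\<lambda>z. z))
      = (LINT z|lborel. J std_triangle (\<lambda>z. z) z + J std_triangle ?n z)"
    using J(1) compact_std_triangle id n
    by (intro integral_cong_AE borel_measurable_add borel_measurable_integrable) auto
  then show ?thesis
    by (simp add: J id n T compact_std_triangle)
qed

lemma integral_cos_int_freq:
  assumes "k \<noteq> 0"
  shows "integral {0..1} (\<lambda>t. cos (2 * pi * (c + of_int k * t))) = 0"
proof -
  have "((\<lambda>t. cos (2 * pi * (c + of_int k * t))) has_integral
      sin (2 * pi * (c + of_int k * 1)) / (2 * pi * of_int k) - sin (2 * pi * (c + of_int k * 0)) / (2 * pi * of_int k)) {0..1}"
    using assms by (intro fundamental_theorem_of_calculus)
      (auto intro!: derivative_eq_intros simp: has_real_derivative_iff_has_vector_derivative[symmetric])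
  moreover have "sin (2 * pi * (c + of_int k * 1)) = sin (2 * pi * c)"
    by (simp add: distrib_left sin_add)
  ultimately show ?thesis
    by (simp add: integral_unique)
qed

section \<open>The change of variables\<close>

lemma x_of_eq_xi: "x_of (2 * u + v, v - u, t) = xi (u, v)"
proof -
  have *: "2 * pi * ((2 * u + v) - (v - u)) / 3 = 2 * pi * u"
    "2 * pi * (2 * (2 * u + v) + (v - u)) / 3 = 2 * pi * (u + v)"
    "2 * pi * ((2 * u + v) + 2 * (v - u)) / 3 = 2 * pi * v"
    by (simp_all add: algebra_simps)
  show ?thesis unfolding x_of_def xi_def split_conv * by (simp only: add_ac)
qed

lemma y_of_eq_eta: "y_of (2 * u + v, v - u, t) = eta (u, v)"
proof -
  have *: "2 * pi * ((2 * u + v) + (v - u)) = 2 * pi * (u + 2 * v)"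
    by (simp add: algebra_simps)
  show ?thesis unfolding y_of_def eta_def split_conv * ..
qed

lemma triangle_star_eq_image: "triangle_star = (\<lambda>z. (xi z, eta z)) ` alcove"
proof -
  have T: "triangle = (\<lambda>(u, v). (2 * u + v, v - u, - (u + 2 * v))) ` alcove"
  proof (intro equalityI subsetI)
    fix t assume t: "t \<in> triangle"
    obtain t1 t2 t3 where t': "t = (t1, t2, t3)" by (cases t)
    show "t \<in> (\<lambda>(u, v). (2 * u + v, v - u, - (u + 2 * v))) ` alcove"
      using t unfolding t'
      \<comment> \<open>Inverse of the linear map
        \<open>(u, v) \<mapsto> (2 * u + v, v - u)\<close>.\<close>
      by (intro image_eqI[of _ _ "((t1 - t2) / 3, (t1 + 2 * t2) / 3)"])
         (auto simp: triangle_def alcove_def field_simps)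
  qed (auto simp: triangle_def alcove_def)
  show ?thesis
    unfolding triangle_star_def T image_image case_prod_unfold x_of_eq_xi y_of_eq_eta prod.collapse ..
qed

section \<open>Injectivity on the alcove, in the variables \<open>p = cos (pi * u)\<close> and
  \<open>q = cos (pi * (u + 2 * v))\<close>\<close>

lemma xi_eq: "xi (u, v) = (2 * (cos (pi * u) ^ 2 + cos (pi * u) * cos (pi * (u + 2 * v))) - 1) / 3"
proof -
  have "cos (2 * pi * v) + cos (2 * pi * (u + v)) = 2 * cos (pi * u) * cos (pi * (u + 2 * v))"
  proof -
    have *: "(2 * pi * v + 2 * pi * (u + v)) / 2 = pi * (u + 2 * v)"
      "(2 * pi * v - 2 * pi * (u + v)) / 2 = - (pi * u)"
      by (simp_all add: field_simps)
    show ?thesis unfolding cos_plus_cos * by simp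
  qed
  moreover have "cos (2 * pi * u) = 2 * cos (pi * u) ^ 2 - 1"
    using cos_double_cos[of "pi * u"] by (simp add: mult_ac)
  ultimately show ?thesis unfolding xi_def by simp
qed

lemma eta_eq: "eta (u, v) = (2 * (cos (pi * (u + 2 * v)) ^ 2
    + cos (pi * (u + 2 * v)) * (4 * cos (pi * u) ^ 3 - 3 * cos (pi * u))) - 1) / 3"
proof -
  have "cos (2 * pi * (2 * u + v)) + cos (2 * pi * (v - u)) = 2 * cos (pi * (u + 2 * v)) * cos (3 * (pi * u))"
  proof -
    have *: "(2 * pi * (2 * u + v) + 2 * pi * (v - u)) / 2 = pi * (u + 2 * v)"
      "(2 * pi * (2 * u + v) - 2 * pi * (v - u)) / 2 = 3 * (pi * u)"
      by (simp_all add: field_simps)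
    show ?thesis unfolding cos_plus_cos * ..
  qed
  moreover have "cos (2 * pi * (u + 2 * v)) = 2 * cos (pi * (u + 2 * v)) ^ 2 - 1"
    using cos_double_cos[of "pi * (u + 2 * v)"] by (simp add: mult_ac)
  ultimately show ?thesis unfolding eta_def cos_treble_cos by simp
qed

text \<open>The angles \<open>pi * u\<close>, \<open>3 * pi * u\<close>,
  \<open>pi * (u + 2 * v)\<close> increase within \<open>[0, pi]\<close>, where cosine decreases;
  the cubic is \<open>cos (3 * pi * u)\<close>, and \<open>u \<le> 1/3\<close>.\<close>

lemma alcove_cos:
  assumes "(u, v) \<in> alcove"
  shows "1/2 \<le> cos (pi * u)" "cos (pi * (u + 2 * v)) \<le> 4 * cos (pi * u) ^ 3 - 3 * cos (pi * u)"
    "4 * cos (pi * u) ^ 3 - 3 * cos (pi * u) \<le> cos (pi * u)"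
    "0 \<le> sin (pi * u)" "0 \<le> sin (pi * (u + 2 * v))"
proof -
  have u: "0 \<le> u" "3 * u \<le> u + 2 * v" "u + 2 * v \<le> 1"
    using assms by (auto simp: alcove_def)
  have le: "0 \<le> pi * u" "pi * u \<le> pi * (1/3)" "pi * u \<le> pi * (3 * u)" "pi * (3 * u) \<le> pi * (u + 2 * v)" "pi * (u + 2 * v) \<le> pi * 1"
    using u by (simp_all only: mult_le_cancel_left_pos[OF pi_gt_zero] mult_nonneg_nonneg pi_ge_zero)
  have "cos (pi / 3) \<le> cos (pi * u)"
    by (rule cos_monotone_0_pi_le; use le in linarith)
  then show "1/2 \<le> cos (pi * u)" by (simp add: cos_60)
  have "cos (pi * (u + 2 * v)) \<le> cos (pi * (3 * u))" "cos (pi * (3 * u)) \<le> cos (pi * u)"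
    by (rule cos_monotone_0_pi_le; use le in linarith)+
  moreover have "cos (pi * (3 * u)) = 4 * cos (pi * u) ^ 3 - 3 * cos (pi * u)"
    using cos_treble_cos[of "pi * u"] by (simp add: mult_ac)
  ultimately show "cos (pi * (u + 2 * v)) \<le> 4 * cos (pi * u) ^ 3 - 3 * cos (pi * u)"
    "4 * cos (pi * u) ^ 3 - 3 * cos (pi * u) \<le> cos (pi * u)" by simp_all
  show "0 \<le> sin (pi * u)" "0 \<le> sin (pi * (u + 2 * v))"
    by (rule sin_ge_zero; use le in linarith)+
qed

text \<open>Solving \<open>p\<^sup>2 + p q = X\<close> for \<open>q\<close> turns the second coordinate into a function of \<open>p\<close> whose
  derivative is \<open>2 (c - q) (q - p) / p\<close> with \<open>c = 4 p\<^sup>3 - 3 p\<close>.\<close>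
lemma second_coordinate_less:
  fixes p q p' q' :: real
  assumes p: "1/2 \<le> p" "p < p'" "p' \<le> 1" and q: "q \<le> 4 * p ^ 3 - 3 * p"
    and X: "p\<^sup>2 + p * q = p'\<^sup>2 + p' * q'"
  shows "q'\<^sup>2 + q' * (4 * p' ^ 3 - 3 * p') < q\<^sup>2 + q * (4 * p ^ 3 - 3 * p)"
proof -
  define X where "X = p\<^sup>2 + p * q"
  \<comment> \<open>The second coordinate along the curve \<open>X = t^2 + t * s\<close>, with
    \<open>s = X / t - t\<close> eliminated.\<close>
  define f where "f t = (X / t)\<^sup>2 - 5 * X + 4 * t\<^sup>2 + 4 * X * t\<^sup>2 - 4 * t ^ 4" for t
  have f: "s\<^sup>2 + s * (4 * t ^ 3 - 3 * t) = f t" if "X = t\<^sup>2 + t * s" "t > 0" for s t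
  proof -
    have "X / t = t + s" using that by (simp add: field_simps power2_eq_square)
    then show ?thesis
      unfolding f_def using that(1) by (simp add: power2_eq_square power3_eq_cube power4_eq_xxxx algebra_simps)
  qed
  have "f p' < f p"
  proof (rule DERIV_neg_imp_decreasing_open[OF p(2)])
    fix t assume t: "p < t" "t < p'"
    define s where "s = X / t - t"
    have t0: "t > 0" "1/2 < t" using t p by auto
    have Xt: "X = t\<^sup>2 + t * s" using t0 by (simp add: s_def field_simps power2_eq_square)
    have "(f has_real_derivative (2 / t) * ((4 * t ^ 3 - 3 * t - s) * (s - t))) (at t)"
    proof -
      have "(f has_real_derivative 2 * (X / t) * (- X / t\<^sup>2) + 8 * t + 8 * X * t - 16 * t ^ 3) (at t)"
        unfolding f_def using t0 by (auto intro!: derivative_eq_intros simp: field_simps power2_eq_square power3_eq_cube)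
      moreover have "2 * (X / t) * (- X / t\<^sup>2) + 8 * t + 8 * X * t - 16 * t ^ 3 = (2 / t) * ((4 * t ^ 3 - 3 * t - s) * (s - t))"
      proof -
        have *: "X / t = t + s" "- X / t\<^sup>2 = - (t + s) / t"
          using t0 unfolding Xt by (simp_all add: field_simps power2_eq_square)
        show ?thesis
          unfolding * using t0 unfolding Xt by (simp add: field_simps) algebra
      qed
      ultimately show ?thesis by simp
    qed
    moreover have "(2 / t) * ((4 * t ^ 3 - 3 * t - s) * (s - t)) < 0"
    proof -
      have p2: "p\<^sup>2 < t\<^sup>2" "1/4 \<le> p\<^sup>2" "p\<^sup>2 \<le> 1"
        using p t power_strict_mono[of p t 2] power_mono[of "1/2" p 2] power_mono[of p 1 2] by (auto simp: power2_eq_square)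
      \<comment> \<open>The bound on \<open>q\<close> persists along the curve:
        \<open>s < 4 * t^3 - 3 * t\<close> amounts to \<open>X < 4 * t^4 - 2 * t^2\<close>, whose
        right side increases in \<open>t^2\<close> from \<open>1/4\<close> on; at \<open>p\<close>
        the weak inequality holds.\<close>
      have "p * q \<le> p * (4 * p ^ 3 - 3 * p)" using p q by (intro mult_left_mono) auto
      then have X1: "X \<le> 4 * (p\<^sup>2)\<^sup>2 - 2 * p\<^sup>2"
        unfolding X_def by (simp add: power2_eq_square power3_eq_cube algebra_simps)
      also have "\<dots> < 4 * (t\<^sup>2)\<^sup>2 - 2 * t\<^sup>2"
      proof -
        have "0 < (t\<^sup>2 - p\<^sup>2) * (4 * (t\<^sup>2 + p\<^sup>2) - 2)" using p2 by (intro mult_pos_pos) auto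
        then show ?thesis by (simp add: power2_eq_square algebra_simps)
      qed
      finally have "0 < t * (4 * t ^ 3 - 3 * t - s)"
        unfolding Xt by (simp add: power2_eq_square power3_eq_cube algebra_simps)
      then have 1: "0 < 4 * t ^ 3 - 3 * t - s" using t0 by (simp add: zero_less_mult_iff)
      \<comment> \<open>Since \<open>p \<le> 1\<close>, the bound on \<open>X\<close> gives
        \<open>X \<le> 2 * p^2 < 2 * t^2\<close>, that is, \<open>s < t\<close>.\<close>
      have "4 * (p\<^sup>2)\<^sup>2 - 2 * p\<^sup>2 \<le> 2 * p\<^sup>2"
        using mult_left_mono[of "p\<^sup>2" 1 "p\<^sup>2"] p2 by (simp add: power2_eq_square)
      then have "t * (s - t) < 0" using X1 p2 unfolding Xt by (simp add: power2_eq_square algebra_simps)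
      then have 2: "s - t < 0" using t0 by (simp add: mult_less_0_iff)
      show ?thesis by (rule mult_pos_neg[OF _ mult_pos_neg[OF 1 2]]) (use t0 in simp)
    qed
    ultimately show "\<exists>y. (f has_real_derivative y) (at t) \<and> y < 0" by blast
  next
    show "continuous_on {p..p'} f"
      unfolding f_def using p by (auto intro!: continuous_intros)
  qed
  then show ?thesis
    using f[of p q] f[of p' q'] X p unfolding X_def by simp
qed

text \<open>On a level curve of \<open>xi\<close> the value of \<open>eta\<close> is strictly
  decreasing in \<open>p\<close>, so \<open>p\<close> agrees; then \<open>q\<close> agrees because
  \<open>p\<close> is nonzero, and cosine is injective on \<open>[0, pi]\<close>.\<close>

lemma inj_on_alcove: "inj_on (\<lambda>z. (xi z, eta z)) alcove"
proof (rule inj_onI, clarify)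
  fix u v u' v'
  assume z: "(u, v) \<in> alcove" "(u', v') \<in> alcove"
    and eq: "xi (u, v) = xi (u', v')" "eta (u, v) = eta (u', v')"
  let ?p = "cos (pi * u)" and ?q = "cos (pi * (u + 2 * v))"
  let ?p' = "cos (pi * u')" and ?q' = "cos (pi * (u' + 2 * v'))"
  have lin: "(2 * r - 1) / 3 = (2 * r' - 1) / 3 \<Longrightarrow> r = r'" for r r' :: real by simp
  have X: "?p\<^sup>2 + ?p * ?q = ?p'\<^sup>2 + ?p' * ?q'"
    and Y: "?q\<^sup>2 + ?q * (4 * ?p ^ 3 - 3 * ?p) = ?q'\<^sup>2 + ?q' * (4 * ?p' ^ 3 - 3 * ?p')"
    by (rule lin[OF eq(1)[unfolded xi_eq]], rule lin[OF eq(2)[unfolded eta_eq]])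
  note a = alcove_cos[OF z(1)] and a' = alcove_cos[OF z(2)]
  have p: "?p = ?p'"
  proof (rule linorder_cases[of ?p ?p'])
    assume "?p < ?p'"
    from less_imp_neq[OF second_coordinate_less[OF a(1) this cos_le_one a(2) X]] Y[symmetric]
    show ?thesis by (rule notE)
  next
    assume "?p' < ?p"
    from less_imp_neq[OF second_coordinate_less[OF a'(1) this cos_le_one a'(2) X[symmetric]]] Y
    show ?thesis by (rule notE)
  qed
  from X have "?p' * ?q = ?p' * ?q'" unfolding p by (simp only: add_left_cancel)
  moreover have "?p' \<noteq> 0" using a'(1) by linarith
  ultimately have q: "?q = ?q'" by (simp only: mult_cancel_left simp_thms)
  have bd: "0 \<le> pi * r" "pi * r \<le> pi" if "0 \<le> r" "r \<le> 1" for r :: real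
    using that by (simp_all add: mult_left_le)
  have b: "0 \<le> u" "u \<le> 1" "0 \<le> u + 2 * v" "u + 2 * v \<le> 1" "0 \<le> u'" "u' \<le> 1" "0 \<le> u' + 2 * v'" "u' + 2 * v' \<le> 1"
    using z by (auto simp: alcove_def)
  have "pi * u = pi * u'"
    by (rule cos_inj_pi[OF bd[OF b(1,2)] bd[OF b(5,6)] p])
  moreover have "pi * (u + 2 * v) = pi * (u' + 2 * v')"
    by (rule cos_inj_pi[OF bd[OF b(3,4)] bd[OF b(7,8)] q])
  ultimately show "u = u' \<and> v = v'" by simp
qed

section \<open>The Jacobian and its cancellation against the weight\<close>

text \<open>The Jacobian determinant of \<open>(xi, eta)\<close>, see
  \<open>det_chart_deriv\<close>, factored so that every factor is nonnegative on the
  alcove.\<close>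

definition jac :: "real \<times> real \<Rightarrow> real" where
  "jac = (\<lambda>(u, v). 16 / 9 * pi\<^sup>2 * sin (pi * u) * sin (pi * (u + 2 * v))
    * (4 * cos (pi * u) ^ 3 - 3 * cos (pi * u) - cos (pi * (u + 2 * v))) * (cos (pi * u) - cos (pi * (u + 2 * v))))"

text \<open>Both factors of the weight are squares, of \<open>2 * s * (p - q) / sqrt 3\<close> and
  \<open>2 * t * (c - q) / 3\<close>, and the product of these roots is a constant multiple of the
  Jacobian. The strict inequalities keep the roots positive.\<close>

lemma jac_weight:
  assumes "0 < u" "u < v" "u + 2 * v < 1"
  shows "\<bar>jac (u, v)\<bar> * weight (-1/2) (-1/2) (xi (u, v), eta (u, v)) = 3"
proof -
  define p q s t c where "p = cos (pi * u)" and "q = cos (pi * (u + 2 * v))" and "s = sin (pi * u)"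
    and "t = sin (pi * (u + 2 * v))" and "c = 4 * p ^ 3 - 3 * p"
  have st: "s\<^sup>2 = 1 - p\<^sup>2" "t\<^sup>2 = 1 - q\<^sup>2"
    by (simp_all add: s_def t_def p_def q_def sin_squared_eq)
  have le: "0 < pi * u" "pi * u < pi * (3 * u)" "pi * (3 * u) < pi * (u + 2 * v)" "pi * (u + 2 * v) < pi * 1"
    using assms by (auto intro!: mult_strict_left_mono)
  have pos: "0 < s" "0 < t" unfolding s_def t_def using le by (intro sin_gt_zero; simp)+
  have "q < cos (pi * (3 * u))" "cos (pi * (3 * u)) < p"
    unfolding p_def q_def using le by (intro cos_monotone_0_pi; simp)+
  moreover have "cos (pi * (3 * u)) = c"
    using cos_treble_cos[of "pi * u"] by (simp add: mult_ac c_def p_def)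
  ultimately have qcp: "0 < c - q" "0 < p - q" by simp_all
  define x y where "x = xi (u, v)" and "y = eta (u, v)"
  have x: "x = (2 * (p\<^sup>2 + p * q) - 1) / 3" and y: "y = (2 * (q\<^sup>2 + q * c) - 1) / 3"
    by (simp_all add: x_def y_def xi_eq eta_eq p_def q_def c_def)
  have "1 + 2 * y - 3 * x\<^sup>2 = 4 / 3 * (1 - p\<^sup>2) * (p - q)\<^sup>2"
    unfolding x y c_def by (simp add: field_simps) algebra
  then have P: "1 + 2 * y - 3 * x\<^sup>2 = (2 * s * (p - q) / sqrt 3)\<^sup>2"
    by (simp add: st(1)[symmetric] power_divide power_mult_distrib)
  have "24 * x ^ 3 - y\<^sup>2 - 12 * x * y - 6 * x - 4 * y - 1 = 4 / 9 * (1 - q\<^sup>2) * (c - q)\<^sup>2"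
    unfolding x y c_def by (simp add: field_simps) algebra
  then have Q: "24 * x ^ 3 - y\<^sup>2 - 12 * x * y - 6 * x - 4 * y - 1 = (2 * t * (c - q) / 3)\<^sup>2"
    by (simp add: st(2)[symmetric] power_divide power_mult_distrib)
  have sq: "(r\<^sup>2) powr (-1/2) = 1 / r" if "r > 0" for r :: real
    using that by (simp add: powr_minus powr_half_sqrt divide_simps)
  \<comment> \<open>The exponents are \<open>-1\<close> and \<open>-3/2\<close>, and
    \<open>3 powr (3/2)\<close> is \<open>3 * sqrt 3\<close>.\<close>
  have K: "(4 * pi\<^sup>2) powr (-1/2 + -1/2) / 3 powr (2 * (-1/2) + -1/2) = 3 * sqrt 3 / (4 * pi\<^sup>2)"
  proof -
    have "(3::real) powr (-3/2) = 3 powr (-1) * 3 powr (-1/2)"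
      by (subst powr_add[symmetric]) simp
    then show ?thesis by (simp add: powr_minus powr_half_sqrt divide_simps)
  qed
  have "weight (-1/2) (-1/2) (x, y) = 3 * sqrt 3 / (4 * pi\<^sup>2)
      * (1 / (2 * s * (p - q) / sqrt 3)) * (1 / (2 * t * (c - q) / 3))"
    unfolding weight_def split_conv P Q K using pos qcp by (subst (1 2) sq) auto
  also have "\<dots> = 27 / (16 * pi\<^sup>2 * s * t * (c - q) * (p - q))"
    using pos qcp by (simp add: field_simps)
  finally have w: "weight (-1/2) (-1/2) (x, y) = 27 / (16 * pi\<^sup>2 * s * t * (c - q) * (p - q))" .
  have "jac (u, v) = 16 / 9 * pi\<^sup>2 * s * t * (c - q) * (p - q)"
    by (simp add: jac_def p_def q_def s_def t_def c_def)
  moreover have "\<dots> > 0" using pos qcp by simp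
  ultimately show ?thesis
    unfolding w[unfolded x_def y_def] using pos qcp by (simp add: field_simps)
qed

section \<open>Transport of integrals between \<open>real ^ 2\<close> and pairs\<close>

definition pair_of :: "real ^ 2 \<Rightarrow> real \<times> real" where
  "pair_of v = (v $ 1, v $ 2)"

lemma continuous_on_pair_of: "continuous_on A pair_of"
  unfolding pair_of_def by (intro continuous_intros)

lemma measurable_pair_of [measurable]: "pair_of \<in> borel_measurable borel"
  by (rule borel_measurable_continuous_onI[OF continuous_on_pair_of])

lemma distr_pair_of: "distr lborel lborel pair_of = lborel"
proof (rule lborel_eqI[symmetric])
  fix l u :: "real \<times> real"
  assume lu: "\<And>b. b \<in> Basis \<Longrightarrow> l \<bullet> b \<le> u \<bullet> b"
  obtain l1 l2 u1 u2 where lu': "l = (l1, l2)" "u = (u1, u2)" by (cases l, cases u)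
  let ?l = "vector [l1, l2] :: real ^ 2" and ?u = "vector [u1, u2] :: real ^ 2"
  have le: "l1 \<le> u1" "l2 \<le> u2"
    using lu[of "(1, 0)"] lu[of "(0, 1)"] by (auto simp: lu' Basis_prod_def)
  have "pair_of -` box l u = box ?l ?u"
    by (auto simp: pair_of_def lu' mem_box_cart forall_2 box_prod vector_2)
  then have "emeasure (distr lborel lborel pair_of) (box l u) = emeasure lborel (box ?l ?u)"
    by (simp add: emeasure_distr)
  \<comment> \<open>The boundary of a box is null, and the content of the closed box is the product
    of its sides.\<close>
  also have "\<dots> = emeasure lborel (cbox ?l ?u)"
    by (simp only: emeasure_lborel_box_eq emeasure_lborel_cbox_eq)
  also have "\<dots> = ennreal (measure lborel (cbox ?l ?u))"
    using emeasure_lborel_cbox_finite[of ?l ?u] by (intro emeasure_eq_ennreal_measure) simp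
  also have "measure lborel (cbox ?l ?u) = (u1 - l1) * (u2 - l2)"
  proof -
    have "cbox ?l ?u \<noteq> {}"
      using le by (simp add: interval_ne_empty_cart forall_2 vector_2)
    then show ?thesis by (simp add: content_cbox_cart UNIV_2 vector_2)
  qed
  also have "\<dots> = (\<Prod>b\<in>Basis. (u - l) \<bullet> b)"
    by (simp add: lu' Basis_prod_def prod.union_disjoint)
  finally show "emeasure (distr lborel lborel pair_of) (box l u) = (\<Prod>b\<in>Basis. (u - l) \<bullet> b)" .
qed simp

text \<open>\<open>pair_of\<close> carries Lebesgue measure to Lebesgue measure, and for Borel
  functions completing the measure changes neither integrability nor value.\<close>

lemma absolutely_integrable_pair_of_iff:
  fixes h :: "real \<times> real \<Rightarrow> real"
  assumes [measurable]: "S \<in> sets borel" "h \<in> borel_measurable borel"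
  shows "set_integrable lborel S h \<longleftrightarrow> (\<lambda>v. h (pair_of v)) absolutely_integrable_on pair_of -` S"
    and "(LINT z:S|lborel. h z) = (LINT v:pair_of -` S|lebesgue. h (pair_of v))"
proof -
  have ind: "indicator (pair_of -` S) v = (indicator S (pair_of v) :: real)" for v
    by (simp add: indicator_def)
  have "set_integrable lborel S h \<longleftrightarrow> integrable (distr lborel lborel pair_of) (\<lambda>z. indicator S z *\<^sub>R h z)"
    by (simp add: set_integrable_def distr_pair_of)
  also have "\<dots> \<longleftrightarrow> integrable lborel (\<lambda>v. indicator S (pair_of v) *\<^sub>R h (pair_of v))"
    by (rule integrable_distr_eq) auto
  also have "\<dots> \<longleftrightarrow> (\<lambda>v. h (pair_of v)) absolutely_integrable_on pair_of -` S"
    unfolding set_integrable_def ind by (rule integrable_completion[symmetric]) simp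
  finally show "set_integrable lborel S h \<longleftrightarrow> (\<lambda>v. h (pair_of v)) absolutely_integrable_on pair_of -` S" .
  have "(LINT z:S|lborel. h z) = integral\<^sup>L (distr lborel lborel pair_of) (\<lambda>z. indicator S z *\<^sub>R h z)"
    by (simp add: set_lebesgue_integral_def distr_pair_of)
  also have "\<dots> = integral\<^sup>L lborel (\<lambda>v. indicator S (pair_of v) *\<^sub>R h (pair_of v))"
    by (rule integral_distr) auto
  also have "\<dots> = (LINT v:pair_of -` S|lebesgue. h (pair_of v))"
    unfolding set_lebesgue_integral_def ind by (rule integral_completion[symmetric]) simp
  finally show "(LINT z:S|lborel. h z) = (LINT v:pair_of -` S|lebesgue. h (pair_of v))" .
qed

section \<open>The change of variables map and its determinant\<close>

definition chart :: "real ^ 2 \<Rightarrow> real ^ 2" where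
  "chart v = xi (pair_of v) *\<^sub>R axis 1 1 + eta (pair_of v) *\<^sub>R axis 2 1"

definition chart_deriv :: "real ^ 2 \<Rightarrow> real ^ 2 \<Rightarrow> real ^ 2" where
  "chart_deriv v h = (let u = v $ 1; w = v $ 1 + 2 * v $ 2; p = cos (pi * u); q = cos (pi * w);
     dp = - sin (pi * u) * (pi * h $ 1); dq = - sin (pi * w) * (pi * (h $ 1 + 2 * h $ 2)) in
   (2 / 3 * ((2 * p + q) * dp + p * dq)) *\<^sub>R axis 1 1
   + (2 / 3 * (q * (12 * p\<^sup>2 - 3) * dp + (2 * q + (4 * p ^ 3 - 3 * p)) * dq)) *\<^sub>R axis 2 1)"

lemma chart_nth: "chart v $ 1 = xi (pair_of v)" "chart v $ 2 = eta (pair_of v)"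
  by (simp_all add: chart_def axis_def)

lemma has_derivative_first_coordinate:
  fixes p q :: "'a::real_normed_vector \<Rightarrow> real"
  assumes [derivative_intros]: "(p has_derivative dp) (at v within S)" "(q has_derivative dq) (at v within S)"
  shows "((\<lambda>v. (2 * ((p v)\<^sup>2 + p v * q v) - 1) / 3) has_derivative
    (\<lambda>h. 2 / 3 * ((2 * p v + q v) * dp h + p v * dq h))) (at v within S)"
  by (auto intro!: derivative_eq_intros simp: fun_eq_iff field_simps)

lemma has_derivative_second_coordinate:
  fixes p q :: "'a::real_normed_vector \<Rightarrow> real"
  assumes [derivative_intros]: "(p has_derivative dp) (at v within S)" "(q has_derivative dq) (at v within S)"
  shows "((\<lambda>v. (2 * ((q v)\<^sup>2 + q v * (4 * (p v) ^ 3 - 3 * p v)) - 1) / 3) has_derivative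
    (\<lambda>h. 2 / 3 * (q v * (12 * (p v)\<^sup>2 - 3) * dp h + (2 * q v + (4 * (p v) ^ 3 - 3 * p v)) * dq h))) (at v within S)"
  by (auto intro!: derivative_eq_intros simp: fun_eq_iff field_simps power2_eq_square power3_eq_cube)

lemma has_derivative_chart: "(chart has_derivative chart_deriv v) (at v within S)"
proof -
  have nth: "((\<lambda>v. v $ i) has_derivative (\<lambda>h. h $ i)) (at v within S)" for i :: 2
    by (rule bounded_linear_imp_has_derivative[OF bounded_linear_vec_nth])
  have p: "((\<lambda>v. cos (pi * v $ 1)) has_derivative (\<lambda>h. - sin (pi * v $ 1) * (pi * h $ 1))) (at v within S)"
    and q: "((\<lambda>v. cos (pi * (v $ 1 + 2 * v $ 2))) has_derivative
      (\<lambda>h. - sin (pi * (v $ 1 + 2 * v $ 2)) * (pi * (h $ 1 + 2 * h $ 2)))) (at v within S)"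
    by (auto intro!: derivative_eq_intros nth simp: fun_eq_iff)
  show ?thesis
    unfolding chart_def[abs_def] chart_deriv_def[abs_def] Let_def pair_of_def xi_eq eta_eq
    by (intro has_derivative_add has_derivative_scaleR_left has_derivative_first_coordinate
        has_derivative_second_coordinate p q)
qed

text \<open>By the chain rule through \<open>p\<close> and \<open>q\<close>: with
  \<open>c = 4 * p^3 - 3 * p\<close>, the derivative in \<open>p\<close>, \<open>q\<close> has
  determinant \<open>8/9 * (c - q) * (p - q)\<close>, and the two cosines contribute
  \<open>2 * pi^2\<close> times the product of the sines.\<close>

lemma det_chart_deriv: "det (matrix (chart_deriv v)) = jac (pair_of v)"
  unfolding det_2 matrix_def chart_deriv_def Let_def jac_def pair_of_def
  by (simp add: axis_def) algebra

lemma continuous_on_xi: "continuous_on A xi" and continuous_on_eta: "continuous_on A eta"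
  and continuous_on_jac: "continuous_on A jac"
  unfolding xi_def eta_def jac_def case_prod_unfold by (intro continuous_intros)+

lemma triangle_star_borel: "triangle_star \<in> sets borel"
  unfolding triangle_star_eq_image
  by (intro borel_compact compact_continuous_image continuous_on_Pair continuous_on_xi continuous_on_eta compact_alcove)

text \<open>The change of variables theorem asks for differentiability and injectivity on the set
  only, so the walls of the alcove, where the Jacobian vanishes, need no separate treatment.\<close>

lemma change_of_variables_chart:
  fixes h :: "real \<times> real \<Rightarrow> real"
  assumes h [measurable]: "h \<in> borel_measurable borel"
  defines "k \<equiv> (\<lambda>z. \<bar>jac z\<bar> * h (xi z, eta z))"
  assumes int: "set_integrable lborel alcove k"
  shows "set_integrable lborel triangle_star h \<and> (LINT z:triangle_star|lborel. h z) = (LINT z:alcove|lborel. k z)"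
proof -
  note [measurable] = borel_compact[OF compact_alcove] triangle_star_borel
  have [measurable]: "xi \<in> borel_measurable borel" "eta \<in> borel_measurable borel" "jac \<in> borel_measurable borel"
    by (intro borel_measurable_continuous_onI continuous_on_xi continuous_on_eta continuous_on_jac)+
  have "(\<lambda>z. (xi z, eta z)) \<in> borel_measurable borel"
    by (intro borel_measurable_continuous_onI continuous_on_Pair continuous_on_xi continuous_on_eta)
  from measurable_compose[OF this h] have k [measurable]: "k \<in> borel_measurable borel"
    unfolding k_def by measurable
  let ?S = "pair_of -` alcove"
  \<comment> \<open>The theorem concerns vector valued integrands, so \<open>h\<close> is read as a
    map into \<open>real ^ 1\<close>.\<close>
  let ?H = "\<lambda>v. vec (h (pair_of v)) :: real ^ 1"
  have S: "?S \<in> sets borel"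
    using measurable_sets[OF measurable_pair_of borel_compact[OF compact_alcove]] by simp
  have pair_chart: "pair_of (chart v) = (xi (pair_of v), eta (pair_of v))" for v
    unfolding pair_of_def[of "chart v"] chart_nth ..
  have inj_pair: "v = w" if "pair_of v = pair_of w" for v w
    using that by (simp add: pair_of_def vec_eq_iff forall_2)
  have inj: "inj_on chart ?S"
  proof (rule inj_onI)
    fix v w assume "v \<in> ?S" "w \<in> ?S" "chart v = chart w"
    then have "pair_of v = pair_of w"
      using inj_onD[OF inj_on_alcove, of "pair_of v" "pair_of w"] pair_chart[of v] pair_chart[of w] by simp
    then show "v = w" by (rule inj_pair)
  qed
  have img: "chart ` ?S = pair_of -` triangle_star"
  proof (intro equalityI subsetI)
    fix w assume "w \<in> pair_of -` triangle_star"
    then obtain z where z: "z \<in> alcove" "pair_of w = (xi z, eta z)"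
      unfolding triangle_star_eq_image by auto
    define v where "v = (vector [fst z, snd z] :: real ^ 2)"
    have v: "pair_of v = z" by (simp add: v_def pair_of_def vector_2)
    then have "w = chart v" using z by (intro inj_pair) (simp add: pair_chart)
    with v z show "w \<in> chart ` ?S" by auto
  qed (auto simp: pair_chart triangle_star_eq_image)
  have k_vec: "\<bar>det (matrix (chart_deriv v))\<bar> *\<^sub>R ?H (chart v) = vec (k (pair_of v))" for v
    unfolding det_chart_deriv pair_chart k_def by (simp add: vec_eq_iff)
  have "(\<lambda>v. \<bar>det (matrix (chart_deriv v))\<bar> *\<^sub>R ?H (chart v)) absolutely_integrable_on ?S \<and>
      integral ?S (\<lambda>v. \<bar>det (matrix (chart_deriv v))\<bar> *\<^sub>R ?H (chart v)) = vec (LINT z:alcove|lborel. k z)"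
    unfolding k_vec
  proof
    have ai: "(\<lambda>v. k (pair_of v)) absolutely_integrable_on ?S"
      using int absolutely_integrable_pair_of_iff(1)[of alcove k] by simp
    then show "(\<lambda>v. vec (k (pair_of v)) :: real ^ 1) absolutely_integrable_on ?S"
      by (simp add: absolutely_integrable_on_1_iff)
    show "integral ?S (\<lambda>v. vec (k (pair_of v)) :: real ^ 1) = vec (LINT z:alcove|lborel. k z)"
      using absolutely_integrable_pair_of_iff(2)[of alcove k] set_lebesgue_integral_eq_integral(2)[OF ai]
      by (simp add: integral_on_1_eq)
  qed
  then have H: "?H absolutely_integrable_on (pair_of -` triangle_star)"
      "integral (pair_of -` triangle_star) ?H = vec (LINT z:alcove|lborel. k z)"
    using has_absolute_integral_change_of_variables[OF _ has_derivative_chart inj] S unfolding img by auto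
  have ai: "(\<lambda>v. h (pair_of v)) absolutely_integrable_on (pair_of -` triangle_star)"
    using H(1) by (simp add: absolutely_integrable_on_1_iff)
  moreover have "integral (pair_of -` triangle_star) (\<lambda>v. h (pair_of v)) = (LINT z:alcove|lborel. k z)"
    using H(2) by (simp add: integral_on_1_eq vec_eq_iff)
  ultimately show ?thesis
    using absolutely_integrable_pair_of_iff[of triangle_star h] set_lebesgue_integral_eq_integral(2)[OF ai] by simp
qed

text \<open>The weight is unbounded near the boundary. Pulled back it cancels the Jacobian and
  leaves a continuous integrand on a compact set, which gives integrability along with the
  value.\<close>

lemma LINT_triangle_star_weight:
  assumes f: "continuous_on UNIV f"
  shows "set_integrable lborel triangle_star (\<lambda>p. f p * weight (-1/2) (-1/2) p)"
    and "(LINT p:triangle_star|lborel. f p * weight (-1/2) (-1/2) p) = 3 * (LINT z:alcove|lborel. f (xi z, eta z))"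
proof -
  define w where "w = weight (-1/2) (-1/2)"
  let ?k = "\<lambda>z. \<bar>jac z\<bar> * (f (xi z, eta z) * w (xi z, eta z))"
  note [measurable] = borel_compact[OF compact_alcove]
  have [measurable]: "f \<in> borel_measurable borel" by (rule borel_measurable_continuous_onI[OF f])
  have [measurable]: "w \<in> borel_measurable borel"
    unfolding w_def weight_def case_prod_unfold borel_prod[symmetric] by measurable
  have [measurable]: "jac \<in> borel_measurable borel"
    by (rule borel_measurable_continuous_onI[OF continuous_on_jac])
  have [measurable]: "(\<lambda>z. (xi z, eta z)) \<in> borel_measurable borel"
    by (intro borel_measurable_continuous_onI continuous_on_Pair continuous_on_xi continuous_on_eta)
  have [measurable]: "(\<lambda>z. w (xi z, eta z)) \<in> borel_measurable borel"
    by (rule measurable_compose[of "\<lambda>z. (xi z, eta z)" borel borel w]) measurable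
  have cont: "continuous_on A (\<lambda>z. f (xi z, eta z))" for A
    by (rule continuous_on_compose2[OF f]) (auto intro!: continuous_on_Pair continuous_on_xi continuous_on_eta)
  then have [measurable]: "(\<lambda>z. f (xi z, eta z)) \<in> borel_measurable borel"
    by (rule borel_measurable_continuous_onI)
  \<comment> \<open>On the walls the right side is 0, as the Jacobian vanishes there, so equality
    holds only off these three lines.\<close>
  have ae: "AE z in lborel. indicator alcove z *\<^sub>R (3 * f (xi z, eta z)) = indicator alcove z *\<^sub>R ?k z"
    using AE_lborel_line[of 1 0 0, simplified] AE_lborel_line[of 1 "-1" 0, simplified] AE_lborel_line[of 1 2 1, simplified]
  proof eventually_elim
    case (elim z)
    obtain u v where z: "z = (u, v)" by (cases z)
    show ?case
    proof (cases "z \<in> alcove")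
      case True
      then have "0 < u" "u < v" "u + 2 * v < 1" using elim by (auto simp: z alcove_def)
      from jac_weight[OF this, folded w_def] show ?thesis by (simp add: z mult.left_commute)
    qed simp
  qed
  have int3: "integrable lborel (\<lambda>z. indicator alcove z *\<^sub>R (3 * f (xi z, eta z)))"
    by (intro borel_integrable_compact compact_alcove continuous_on_mult continuous_on_const cont)
  then have "set_integrable lborel alcove ?k"
    unfolding set_integrable_def by (subst integrable_cong_AE[OF _ _ ae, symmetric]) auto
  from change_of_variables_chart[OF _ this]
  have *: "set_integrable lborel triangle_star (\<lambda>p. f p * w p)"
    "(LINT p:triangle_star|lborel. f p * w p) = (LINT z:alcove|lborel. ?k z)"
    by simp_all
  have "(LINT z:alcove|lborel. ?k z) = (LINT z:alcove|lborel. 3 * f (xi z, eta z))"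
    unfolding set_lebesgue_integral_def by (rule integral_cong_AE[OF _ _ ae, symmetric]) auto
  with * show "set_integrable lborel triangle_star (\<lambda>p. f p * weight (-1/2) (-1/2) p)"
    "(LINT p:triangle_star|lborel. f p * weight (-1/2) (-1/2) p) = 3 * (LINT z:alcove|lborel. f (xi z, eta z))"
    unfolding w_def by simp_all
qed

section \<open>The cubature rule\<close>

lemma LINT_box_ctrig:
  "(LINT z:cbox (0, 0) (1, 1)|lborel. ctrig k l z) = (if k = 0 \<and> l = 0 then 1 else 0)"
proof -
  have cont: "continuous_on A (ctrig k l)" for A
    unfolding ctrig_def case_prod_unfold by (intro continuous_intros)
  have "set_integrable lborel (cbox (0, 0) (1, 1)) (ctrig k l)"
    unfolding set_integrable_def by (intro borel_integrable_compact compact_cbox cont)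
  then have "(LINT z:cbox (0, 0) (1, 1)|lborel. ctrig k l z) = integral (cbox (0, 0) (1, 1)) (ctrig k l)"
    by (rule set_borel_integral_eq_integral)
  also have "\<dots> = integral {0..1} (\<lambda>u. integral {0..1} (\<lambda>v. cos (2 * pi * (of_int k * u + of_int l * v))))"
    using integral_prod_continuous[OF cont, of 0 0 1 1] by (simp add: ctrig_def)
  also have "\<dots> = (if k = 0 \<and> l = 0 then 1 else 0)"
  proof (cases "l = 0")
    case True
    then show ?thesis using integral_cos_int_freq[of k 0] by simp
  next
    case False
    then show ?thesis by (simp add: integral_cos_int_freq)
  qed
  finally show ?thesis .
qed

text \<open>Both sides are linear, and on \<open>ctrig k l\<close> both are 1 for the zero frequency
  and 0 otherwise, by \<open>no_aliasing\<close>. Continuity is carried along since additivity of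
  the integral needs integrability.\<close>

lemma trig_span_quadrature:
  assumes "n \<ge> 1" "F \<in> trig_span m" "m < 2 * int n"
  shows "continuous_on UNIV F \<and> (LINT z:cbox (0, 0) (1, 1)|lborel. F z)
    = 1 / (real n)\<^sup>2 * (\<Sum>(a, b)\<in>{0..<int n} \<times> {0..<int n}. F (of_int a / real n, of_int b / real n))"
  using assms(2)
proof induction
  case (ctrig k l)
  have "continuous_on UNIV (ctrig k l)"
    unfolding ctrig_def case_prod_unfold by (intro continuous_intros)
  moreover have "int n dvd k \<and> int n dvd l \<longleftrightarrow> k = 0 \<and> l = 0"
    using no_aliasing[of "int n" k l] ctrig assms(1,3) by auto
  ultimately show ?case
    unfolding sum_ctrig_grid[OF assms(1)] LINT_box_ctrig using assms(1) by simp
next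
  case (add F G)
  have "set_integrable lborel (cbox (0, 0) (1, 1)) H" if "continuous_on UNIV H" for H :: "real \<times> real \<Rightarrow> real"
    unfolding set_integrable_def
    by (rule borel_integrable_compact[OF compact_cbox continuous_on_subset[OF that subset_UNIV]])
  then show ?case
    using add by (auto intro!: continuous_intros simp: set_integral_add case_prod_unfold sum.distrib distrib_left)
next
  case (scale F c)
  then show ?case
    by (auto intro!: continuous_intros simp: case_prod_unfold sum_distrib_left[symmetric])
qed

section \<open>Symmetries of \<open>xi\<close> and \<open>eta\<close>\<close>

lemma cos_int_minus: "cos (2 * pi * (of_int m - t)) = cos (2 * pi * t)"
proof -
  have "2 * pi * (of_int m - t) = 2 * pi * of_int m - 2 * pi * t" by (simp add: algebra_simps)
  then show ?thesis by (simp add: cos_diff)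
qed

lemma xi_eta_swap: "xi (v, u) = xi (u, v)" "eta (v, u) = eta (u, v)"
proof -
  show "xi (v, u) = xi (u, v)" by (simp add: xi_def add_ac)
  have "cos (2 * pi * (u - v)) = cos (2 * pi * (v - u))"
    using cos_int_minus[of 0 "v - u"] by simp
  then show "eta (v, u) = eta (u, v)" by (simp add: eta_def add_ac)
qed

lemma xi_eta_reflect: "xi (1 - u - v, v) = xi (u, v)" "eta (1 - u - v, v) = eta (u, v)"
proof -
  \<comment> \<open>Up to sign, each new argument is an integer minus an old one; evenness and
    periodicity then only permute the cosines.\<close>
  have *: "1 - u - v = of_int 1 - (u + v)" "1 - u - v + v = of_int 1 - u"
    "2 * (1 - u - v) + v = of_int 2 - (2 * u + v)" "v - (1 - u - v) = - (of_int 1 - (u + 2 * v))"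
    "1 - u - v + 2 * v = of_int 1 - - (v - u)"
    by simp_all
  show "xi (1 - u - v, v) = xi (u, v)"
    unfolding xi_def split_conv *(2) unfolding *(1) cos_int_minus by simp
  show "eta (1 - u - v, v) = eta (u, v)"
    unfolding eta_def split_conv *(3-5) cos_int_minus mult_minus_right cos_minus by simp
qed

lemma xi_eta_neg: "xi (1 - u, 1 - v) = xi (u, v)" "eta (1 - u, 1 - v) = eta (u, v)"
proof -
  have *: "1 - u = of_int 1 - u" "1 - v = of_int 1 - v" "1 - u + (1 - v) = of_int 2 - (u + v)"
    "2 * (1 - u) + (1 - v) = of_int 3 - (2 * u + v)" "1 - v - (1 - u) = of_int 0 - (v - u)"
    "1 - u + 2 * (1 - v) = of_int 3 - (u + 2 * v)"
    by simp_all
  show "xi (1 - u, 1 - v) = xi (u, v)"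
    unfolding xi_def split_conv *(3) unfolding *(1,2) cos_int_minus ..
  show "eta (1 - u, 1 - v) = eta (u, v)"
    unfolding eta_def split_conv *(4-6) cos_int_minus ..
qed

lemma sum_Upsilon_eq_grid:
  fixes f :: "real \<times> real \<Rightarrow> real"
  assumes "n \<ge> 1"
  shows "(\<Sum>j\<in>Upsilon n. omega n j * f (x_of (scaled n j), y_of (scaled n j)))
    = (\<Sum>(a, b)\<in>{0..<int n} \<times> {0..<int n}. f (xi (of_int a / real n, of_int b / real n), eta (of_int a / real n, of_int b / real n)))"
proof (rule sum_Upsilon_eq_sum_square[OF assms])
  fix a b :: int
  let ?u = "of_int a / real n" and ?v = "of_int b / real n"
  have r: "of_int (int n - a - b) / real n = 1 - ?u - ?v" and m: "of_int (int n - a) / real n = 1 - ?u"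
    "of_int (int n - b) / real n = 1 - ?v"
    using assms by (simp_all add: diff_divide_distrib)
  show "f (xi (?v, ?u), eta (?v, ?u)) = f (xi (?u, ?v), eta (?u, ?v))"
    unfolding xi_eta_swap[of ?v] ..
  show "f (xi (of_int (int n - a - b) / real n, ?v), eta (of_int (int n - a - b) / real n, ?v)) = f (xi (?u, ?v), eta (?u, ?v))"
    unfolding r xi_eta_reflect ..
  show "f (xi (of_int (int n - a) / real n, of_int (int n - b) / real n), eta (of_int (int n - a) / real n, of_int (int n - b) / real n))
      = f (xi (?u, ?v), eta (?u, ?v))"
    unfolding m xi_eta_neg ..
  have "scaled n (2 * a + b, b - a, - (a + 2 * b)) = (2 * ?u + ?v, ?v - ?u, of_int (- (a + 2 * b)) / real n)"
    by (simp add: scaled_def add_divide_distrib diff_divide_distrib)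
  then show "f (x_of (scaled n (2 * a + b, b - a, - (a + 2 * b))), y_of (scaled n (2 * a + b, b - a, - (a + 2 * b))))
      = f (xi (?u, ?v), eta (?u, ?v))"
    by (simp only: x_of_eq_xi y_of_eq_eta)
qed

text \<open>Twelve alcoves make up the square and the weight contributes a factor 3, whence the
  factor 4, later identified as \<open>norm_const\<close>.\<close>

lemma monomial_cubature:
  fixes n k1 k2 :: nat
  assumes "n \<ge> 1" "2 * k1 + 3 * k2 \<le> 2 * n - 1"
  defines "f \<equiv> (\<lambda>(x, y). x ^ k1 * y ^ k2) :: real \<times> real \<Rightarrow> real"
  shows "set_integrable lborel triangle_star (\<lambda>p. f p * weight (-1/2) (-1/2) p)"
    and "4 * (LINT p:triangle_star|lborel. f p * weight (-1/2) (-1/2) p)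
      = 1 / (real n)\<^sup>2 * (\<Sum>j\<in>Upsilon n. omega n j * f (x_of (scaled n j), y_of (scaled n j)))"
proof -
  define F where "F z = f (xi z, eta z)" for z
  have f: "continuous_on UNIV f"
    unfolding f_def case_prod_unfold by (intro continuous_intros)
  show "set_integrable lborel triangle_star (\<lambda>p. f p * weight (-1/2) (-1/2) p)"
    by (rule LINT_triangle_star_weight[OF f])
  have "F = (\<lambda>z. xi z ^ k1 * eta z ^ k2)" by (simp add: F_def f_def fun_eq_iff)
  then have "F \<in> trig_span (2 * int n - 1)"
    using monomial_in_trig_span[of k1 k2 "2 * int n - 1"] assms(1,2) by simp
  from trig_span_quadrature[OF assms(1) this]
  have cont: "continuous_on UNIV F" and quad: "(LINT z:cbox (0, 0) (1, 1)|lborel. F z)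
    = 1 / (real n)\<^sup>2 * (\<Sum>(a, b)\<in>{0..<int n} \<times> {0..<int n}. F (of_int a / real n, of_int b / real n))"
    by auto
  have "4 * (LINT p:triangle_star|lborel. f p * weight (-1/2) (-1/2) p) = 12 * (LINT z:alcove|lborel. F z)"
    using LINT_triangle_star_weight(2)[OF f] by (simp add: F_def)
  also have "\<dots> = (LINT z:cbox (0, 0) (1, 1)|lborel. F z)"
    by (rule LINT_box_eq_LINT_alcove[symmetric, OF cont])
       (simp_all only: F_def xi_eta_reflect xi_eta_neg, simp only: xi_eta_swap)
  also have "\<dots> = 1 / (real n)\<^sup>2 * (\<Sum>j\<in>Upsilon n. omega n j * f (x_of (scaled n j), y_of (scaled n j)))"
    unfolding sum_Upsilon_eq_grid[OF assms(1)] using quad by (simp only: F_def)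
  finally show "4 * (LINT p:triangle_star|lborel. f p * weight (-1/2) (-1/2) p)
      = 1 / (real n)\<^sup>2 * (\<Sum>j\<in>Upsilon n. omega n j * f (x_of (scaled n j), y_of (scaled n j)))" .
qed

text \<open>The rule itself gives the total mass: for \<open>n = 1\<close> and the constant 1 the
  only node is the origin, with weight 1.\<close>

lemma norm_const_value: "norm_const (-1/2) (-1/2) = 4"
proof -
  have "a = 0 \<and> b = 0 \<longleftrightarrow> 0 \<le> a \<and> a \<le> b \<and> a + 2 * b \<le> 1" for a b :: int
    by presburger
  then have "{(a, b). 0 \<le> a \<and> a \<le> b \<and> a + 2 * b \<le> int 1} = {(0, 0)}"
    by auto
  then have "Upsilon 1 = {(0, 0, 0)}"
    unfolding Upsilon_eq_image by simp
  then have "4 * (LINT p:triangle_star|lborel. weight (-1/2) (-1/2) p) = 1"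
    using monomial_cubature(2)[of 1 0 0] by (simp add: omega_def case_prod_unfold)
  then have I: "(LINT p:triangle_star|lborel. weight (-1/2) (-1/2) p) = 1 / 4"
    by linarith
  show ?thesis unfolding norm_const_def I by simp
qed

theorem theorem6p3:
  fixes n :: nat and f :: "real \<times> real \<Rightarrow> real"
  assumes "n \<ge> 1"
    and "f \<in> Pi_star (2 * n - 1)"
  shows "norm_const (-1/2) (-1/2) * (LINT p:triangle_star|lborel. f p * weight (-1/2) (-1/2) p)
    = 1 / (real n)\<^sup>2 * (\<Sum>j\<in>Upsilon n. omega n j * f (x_of (scaled n j), y_of (scaled n j)))"
proof -
  interpret V: vector_space scale_fun by (rule vector_space_scale_fun)
  let ?w = "weight (-1/2) (-1/2)"
  define R where "R f = 1 / (real n)\<^sup>2 * (\<Sum>j\<in>Upsilon n. omega n j * f (x_of (scaled n j), y_of (scaled n j)))"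
    for f :: "real \<times> real \<Rightarrow> real"
  have "f \<in> V.span {(\<lambda>(x, y). x ^ k1 * y ^ k2) | k1 k2 :: nat. 2 * k1 + 3 * k2 \<le> 2 * n - 1}"
    using assms(2) unfolding Pi_star_def .
  \<comment> \<open>Integrability belongs to the induction claim because the integral of a sum
    splits only for integrable summands.\<close>
  then have "set_integrable lborel triangle_star (\<lambda>p. f p * ?w p) \<and> 4 * (LINT p:triangle_star|lborel. f p * ?w p) = R f"
  proof (induction rule: V.span_induct_alt)
    case base
    then show ?case by (simp add: R_def set_integrable_def)
  next
    case (step c m f)
    then obtain k1 k2 :: nat where m: "m = (\<lambda>(x, y). x ^ k1 * y ^ k2)" "2 * k1 + 3 * k2 \<le> 2 * n - 1" by auto
    note mono = monomial_cubature[OF assms(1) m(2), folded m(1) R_def]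
    define g where "g = (\<lambda>p. c * m p) + f"
    have g: "g p = c * m p + f p" for p by (simp add: g_def)
    have "R g = c * R m + R f"
      by (simp add: R_def g algebra_simps sum.distrib sum_distrib_left)
    moreover have "g p * ?w p = c * (m p * ?w p) + f p * ?w p" for p
      by (simp add: g algebra_simps)
    ultimately show ?case
      unfolding g_def[symmetric] using mono step by (simp add: set_integral_add)
  qed
  then show ?thesis unfolding norm_const_value by (simp add: R_def)
qed

end
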